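(* Suppose $V$ is convex and $\beta$-smooth ($\beta>0$), that $\mathcal F$ admits a minimizer over $\mathsf{BW}(\mathbb R^d)$, and that $0<\eta<1/\beta$. Then there exists a minimizer $\pi_\star$ of $\mathcal F$ over $\mathsf{BW}(\mathbb R^d)$ such that the iterates $(p_k)$ of (deterministic) FB--GVI satisfy $W_2(p_k,\pi_\star)\to 0$ as $k\to\infty$.
   Context: $\mathsf{BW}(\mathbb R^d)$ is the set of Gaussian distributions $\mathcal N(m,\Sigma)$ on $\mathbb R^d$ with $m\in\mathbb R^d$ and $\Sigma$ symmetric positive definite, endowed with the 2-Wasserstein distance $W_2$. $V:\mathbb R^d\to\mathbb R$ is twice continuously differentiable; it is $\beta$-smooth if $-\beta I\preceq\nabla^2V(x)\preceq\beta I$ for all $x$, and convex if $\nabla^2 V(x)\succeq 0$ for all $x$. For $\mu\in\mathsf{BW}(\mathbb R^d)$: potential $\mathcal V(\mu)=\int V\,d\mu$, entropy $\mathcal H(\mu)=\int\log\mu(x)\,d\mu(x)$ (identifying $\mu$ with its Lebesgue density), and $\mathcal F=\mathcal V+\mathcal H$. FB--GVI with step size $\eta>0$ and initialization $p_0=\mathcal N(m_0,\Sigma_0)\in\mathsf{BW}(\mathbb R^d)$: given $p_k=\mathcal N(m_k,\Sigma_k)$, set $b_k=\mathbb E_{p_k}\nabla V$, $S_k=\mathbb E_{p_k}\nabla^2V$, $m_{k+1}=m_k-\eta b_k$, $\Sigma_{k+1/2}=(I-\eta S_k)\Sigma_k(I-\eta S_k)$, $\Sigma_{k+1}=\tfrac12\big(\Sigma_{k+1/2}+2\eta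 I+[\Sigma_{k+1/2}(\Sigma_{k+1/2}+4\eta I)]^{1/2}\big)$ (principal PSD square root; the two factors commute), and $p_{k+1}=\mathcal N(m_{k+1},\Sigma_{k+1})$. *)

theory Defs
  imports "HOL-Probability.Probability"
begin

definition sym_mat :: "real^'n^'n \<Rightarrow> bool" where
  "sym_mat A \<longleftrightarrow> transpose A = A"

definition psd_mat :: "real^'n^'n \<Rightarrow> bool" where
  "psd_mat A \<longleftrightarrow> sym_mat A \<and> (\<forall>x. 0 \<le> x \<bullet> (A *v x))"

definition spd_mat :: "real^'n^'n \<Rightarrow> bool" where
  "spd_mat A \<longleftrightarrow> sym_mat A \<and> (\<forall>x. x \<noteq> 0 \<longrightarrow> 0 < x \<bullet> (A *v x))"

definition psd_sqrt :: "real^'n^'n \<Rightarrow> real^'n^'n" where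
  "psd_sqrt A = (THE S. psd_mat S \<and> S ** S = A)"

definition gauss_pdf :: "real^'n \<Rightarrow> real^'n^'n \<Rightarrow> real^'n \<Rightarrow> real" where
  "gauss_pdf m S x =
     (2 * pi) powr (- real CARD('n) / 2) * det S powr (- 1 / 2)
     * exp (- ((x - m) \<bullet> (matrix_inv S *v (x - m))) / 2)"

definition gauss :: "real^'n \<Rightarrow> real^'n^'n \<Rightarrow> (real^'n) measure" where
  "gauss m S = density lborel (\<lambda>x. ennreal (gauss_pdf m S x))"

definition potential :: "(real^'n \<Rightarrow> real) \<Rightarrow> real^'n \<Rightarrow> real^'n^'n \<Rightarrow> real" where
  "potential V m S = (\<integral>x. V x \<partial>gauss m S)"

definition entropy :: "real^'n \<Rightarrow> real^'n^'n \<Rightarrow> real" where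
  "entropy m S = (\<integral>x. ln (gauss_pdf m S x) \<partial>gauss m S)"

definition free_energy :: "(real^'n \<Rightarrow> real) \<Rightarrow> real^'n \<Rightarrow> real^'n^'n \<Rightarrow> real" where
  "free_energy V m S = potential V m S + entropy m S"

definition is_BW_minimizer :: "(real^'n \<Rightarrow> real) \<Rightarrow> real^'n \<Rightarrow> real^'n^'n \<Rightarrow> bool" where
  "is_BW_minimizer V m S \<longleftrightarrow> spd_mat S \<and>
     (\<forall>m' S'. spd_mat S' \<longrightarrow> free_energy V m S \<le> free_energy V m' S')"

definition couplings :: "'a::euclidean_space measure \<Rightarrow> 'a measure \<Rightarrow> ('a \<times> 'a) measure set" where
  "couplings \<mu> \<nu> = {\<pi>. prob_space \<pi> \<and> sets \<pi> = sets (borel \<Otimes>\<^sub>M borel)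
      \<and> distr \<pi> borel fst = \<mu> \<and> distr \<pi> borel snd = \<nu>}"

definition W2 :: "'a::euclidean_space measure \<Rightarrow> 'a measure \<Rightarrow> real" where
  "W2 \<mu> \<nu> = sqrt (enn2real (INF \<pi>\<in>couplings \<mu> \<nu>.
      \<integral>\<^sup>+ z. ennreal ((norm (fst z - snd z))\<^sup>2) \<partial>\<pi>))"

definition fb_step :: "real \<Rightarrow> (real^'n \<Rightarrow> real^'n) \<Rightarrow> (real^'n \<Rightarrow> real^'n^'n)
    \<Rightarrow> (real^'n) \<times> (real^'n^'n) \<Rightarrow> (real^'n) \<times> (real^'n^'n)" where
  "fb_step \<eta> gradV hessV p =
    (let m = fst p; S = snd p;
         b = (\<integral>x. gradV x \<partial>gauss m S);
         H = (\<integral>x. hessV x \<partial>gauss m S);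
         A = mat 1 - \<eta> *\<^sub>R H;
         Sh = A ** S ** A
     in (m - \<eta> *\<^sub>R b,
         (1/2) *\<^sub>R (Sh + (2 * \<eta>) *\<^sub>R mat 1 + psd_sqrt (Sh ** (Sh + (4 * \<eta>) *\<^sub>R mat 1)))))"

primrec fb_gvi :: "real \<Rightarrow> (real^'n \<Rightarrow> real^'n) \<Rightarrow> (real^'n \<Rightarrow> real^'n^'n)
    \<Rightarrow> real^'n \<Rightarrow> real^'n^'n \<Rightarrow> nat \<Rightarrow> (real^'n) \<times> (real^'n^'n)" where
  "fb_gvi \<eta> gradV hessV m0 S0 0 = (m0, S0)"
| "fb_gvi \<eta> gradV hessV m0 S0 (Suc k) = fb_step \<eta> gradV hessV (fb_gvi \<eta> gradV hessV m0 S0 k)"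

end

theory Submission
  imports Defs
begin

text \<open>Write a Gaussian as the law of \<open>m + A \<xi>\<close> with \<open>\<xi>\<close> standard normal and \<open>A A\<^sup>T = \<Sigma>\<close>. By Stein's identity,
  the potential energy \<open>E V(m + A \<xi>)\<close> is a convex \<open>\<beta>\<close>-smooth function of \<open>(m, A)\<close> with gradient \<open>(b, S A)\<close>,
  and the entropy is \<open>- ln \<bar>det A\<bar>\<close> up to a constant. Hence FB--GVI is a proximal gradient step on the factors,
  and, after rotating the factor of the comparison Gaussian so that it is optimally aligned
  with the half step, the usual telescoping inequality
  \<open>d\<^sub>+\<^sup>2 \<le> d\<^sup>2 - 2 \<eta> (F(p\<^sub>+) - F(q))\<close> holds for the Euclidean distance \<open>d\<close> between the factors, which dominates \<open>W\<^sub>2\<close>.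
  So the energies converge to the minimum and the factors stay bounded. A cluster point of the factors is
  nondegenerate because its energy is finite, so it is a minimizer, and the inequality restarted with
  this minimizer as \<open>q\<close> shows that the whole sequence converges to it.\<close>

section \<open>Symmetric matrices\<close>

text \<open>A factor of a covariance is determined only up to a rotation on the right, and this
  freedom carries the proof. The gradient inequality for the potential holds against every factor B
  of the comparison covariance. For - ln |det A|, which is not convex on matrices, a subgradient
  inequality is available only when B is in polar position to the half step. Replacing B by B U
  between these two parts changes neither the Gaussian nor the Frobenius norm of the factor, and it
  can only increase the inner product with the half step, so the error made in the telescoping has
  the favourable sign. The rotation differs from step to step; hence the estimate is kept as a
  statement about some pair of factors and not about a distance between fixed matrices. W2 itself
  enters only through the upper bound given by one explicit coupling.\<close>

lemma inner_matrix_vector_transpose: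
  fixes A :: "real^'n^'m"
  shows "x \<bullet> (A *v y) = (transpose A *v x) \<bullet> y"
  by (simp add: dot_lmul_matrix)

lemma sym_mat_inner: "sym_mat A \<Longrightarrow> x \<bullet> (A *v y) = (A *v x) \<bullet> y"
  by (simp only: inner_matrix_vector_transpose sym_mat_def)

text \<open>For small t of sign opposite to a, the linear term outweighs the quadratic one. It
  serves as the first-order condition at a maximum.\<close>

lemma quadratic_nonneg_imp_linear_zero:
  fixes a b :: real
  assumes "\<And>t. 0 \<le> 2 * t * a + t\<^sup>2 * b"
  shows "a = 0"
proof (rule ccontr)
  assume "a \<noteq> 0"
  \<comment> \<open>Taking c positive and above b makes the value at t = -a/c equal to a^2/c times a
    factor below -1.\<close>
  define c where "c = \<bar>b\<bar> + 1"
  have c: "c > 0" "b < c" by (auto simp: c_def)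
  have "0 \<le> 2 * (- a / c) * a + (- a / c)\<^sup>2 * b" by (rule assms)
  also have "\<dots> = a\<^sup>2 / c * (b / c - 2)"
    using c by (simp add: field_simps power2_eq_square)
  also have "\<dots> < 0"
  proof -
    have "b / c < 1" using c by simp
    then have "b / c - 2 < 0" by linarith
    then show ?thesis using \<open>a \<noteq> 0\<close> c by (intro mult_pos_neg) auto
  qed
  finally show False by simp
qed

text \<open>Rayleigh's principle: v maximizes the quadratic form on the unit sphere of W, so c |x|^2
  - x . A x is nonnegative on W and vanishes at v; its first variation at v is therefore
  zero.\<close>

lemma sym_mat_eigenvector_in_subspace:
  fixes A :: "real^'n^'n"
  assumes sym: "sym_mat A" and W: "subspace W" "W \<noteq> {0}"
    and inv: "\<And>w. w \<in> W \<Longrightarrow> A *v w \<in> W"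
  obtains v c where "v \<in> W" "norm v = 1" "A *v v = c *\<^sub>R v"
proof -
  let ?K = "W \<inter> sphere 0 1"
  obtain u where u: "u \<in> W" "u \<noteq> 0" using W subspace_0 by blast
  have "(1 / norm u) *\<^sub>R u \<in> ?K"
    using u W by (simp add: subspace_scale)
  then have ne: "?K \<noteq> {}" by blast
  have cpt: "compact ?K"
    by (intro closed_Int_compact closed_subspace W compact_sphere)
  have "continuous_on ?K (\<lambda>x. x \<bullet> (A *v x))"
    by (intro continuous_intros)
  then obtain v where v: "v \<in> ?K" "\<And>x. x \<in> ?K \<Longrightarrow> x \<bullet> (A *v x) \<le> v \<bullet> (A *v v)"
    using continuous_attains_sup[OF cpt ne] by blast
  define c where "c = v \<bullet> (A *v v)"
  have nv: "norm v = 1" "v \<in> W" using v by auto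
  have q: "0 \<le> c * (x \<bullet> x) - x \<bullet> (A *v x)" if "x \<in> W" for x
  proof (cases "x = 0")
    case False
    have "(1 / norm x) *\<^sub>R x \<in> ?K" using that False W by (simp add: subspace_scale)
    from v(2)[OF this] have "(x \<bullet> (A *v x)) / (norm x)\<^sup>2 \<le> c"
      by (simp add: c_def matrix_vector_mult_scaleR power2_eq_square)
    then show ?thesis using False by (simp add: field_simps power2_norm_eq_inner)
  qed simp
  \<comment> \<open>The residual is an admissible direction because W is invariant, and the first
    variation in this direction is 2 |w|^2.\<close>
  define w where "w = c *\<^sub>R v - A *v v"
  have w: "w \<in> W" unfolding w_def using nv W inv by (intro subspace_diff subspace_scale) auto
  have vv: "v \<bullet> v = 1" using nv(1) by (simp add: norm_eq_1)
  have "0 \<le> 2 * t * (w \<bullet> w) + t\<^sup>2 * (c * (w \<bullet> w) - w \<bullet> (A *v w))" for t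
  proof -
    have "v + t *\<^sub>R w \<in> W" using w nv W by (intro subspace_add subspace_scale)
    from q[OF this] have "0 \<le> c * ((v + t *\<^sub>R w) \<bullet> (v + t *\<^sub>R w)) - (v + t *\<^sub>R w) \<bullet> (A *v (v + t *\<^sub>R w))" .
    also have "\<dots> = c - v \<bullet> (A *v v) + 2 * t * (c * (v \<bullet> w)) - t * (w \<bullet> (A *v v)) - t * (v \<bullet> (A *v w))
        + t\<^sup>2 * (c * (w \<bullet> w) - w \<bullet> (A *v w))"
      by (simp add: algebra_simps inner_add_left inner_add_right matrix_vector_mult_scaleR vv
          power2_eq_square inner_commute)
    also have "v \<bullet> (A *v w) = w \<bullet> (A *v v)"
      using sym_mat_inner[OF sym, of v w] by (simp add: inner_commute)
    also have "c - v \<bullet> (A *v v) + 2 * t * (c * (v \<bullet> w)) - t * (w \<bullet> (A *v v)) - t * (w \<bullet> (A *v v))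
        = 2 * t * (w \<bullet> w)"
      unfolding w_def
      by (simp add: c_def[symmetric] algebra_simps inner_diff_left inner_diff_right inner_commute vv)
    finally show ?thesis .
  qed
  then have "w \<bullet> w = 0" by (rule quadratic_nonneg_imp_linear_zero)
  then have "A *v v = c *\<^sub>R v" by (simp add: w_def)
  with nv show thesis by (intro that)
qed

text \<open>An eigenvector is split off and the induction continues on its orthogonal complement
  within W, which symmetry keeps invariant. General invariant subspaces appear for the sake of this
  induction; the case of interest is W = UNIV.\<close>

lemma sym_mat_eigenbasis_of_subspace:
  fixes A :: "real^'n^'n"
  assumes sym: "sym_mat A"
  shows "subspace W \<Longrightarrow> (\<And>w. w \<in> W \<Longrightarrow> A *v w \<in> W) \<Longrightarrow>
    \<exists>B. B \<subseteq> W \<and> pairwise orthogonal B \<and> (\<forall>b\<in>B. norm b = 1) \<and> W \<subseteq> span B \<and>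
        (\<forall>b\<in>B. \<exists>c. A *v b = c *\<^sub>R b)"
proof (induction "dim W" arbitrary: W rule: less_induct)
  case less
  show ?case
  proof (cases "W = {0}")
    case True
    then show ?thesis by (intro exI[of _ "{}"]) auto
  next
    case False
    then obtain v c where v: "v \<in> W" "norm v = 1" "A *v v = c *\<^sub>R v"
      using sym_mat_eigenvector_in_subspace[OF sym less.prems(1) _ less.prems(2)] by metis
    have vv: "v \<bullet> v = 1" using v(2) by (simp add: norm_eq_1)
    define U where "U = W \<inter> {w. v \<bullet> w = 0}"
    have U: "subspace U" unfolding U_def
      by (intro subspace_inter less.prems subspace_hyperplane)
    have inv: "A *v w \<in> U" if "w \<in> U" for w
      using that less.prems(2) v(3) by (auto simp: U_def sym_mat_inner[OF sym])
    have "v \<notin> U" by (simp add: U_def vv)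
    then have "span U \<subset> span W"
      unfolding span_eq_iff[THEN iffD2, OF U] span_eq_iff[THEN iffD2, OF less.prems(1)]
      using v(1) by (metis U_def inf_le1 psubsetI)
    then have "dim U < dim W" by (rule dim_psubset)
    from less.hyps[OF this U inv] obtain B where B: "B \<subseteq> U" "pairwise orthogonal B"
      "\<forall>b\<in>B. norm b = 1" "U \<subseteq> span B" "\<forall>b\<in>B. \<exists>c. A *v b = c *\<^sub>R b" by blast
    have "W \<subseteq> span (insert v B)"
    proof
      fix w assume w: "w \<in> W"
      define u where "u = w - (v \<bullet> w) *\<^sub>R v"
      have "u \<in> U" unfolding U_def u_def using w v less.prems(1)
        by (auto intro: subspace_diff subspace_scale simp: inner_diff_right vv)
      then have "u \<in> span (insert v B)" using B(4) span_mono[of B "insert v B"] by blast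
      moreover have "(v \<bullet> w) *\<^sub>R v \<in> span (insert v B)" by (intro span_scale span_base) simp
      ultimately have "u + (v \<bullet> w) *\<^sub>R v \<in> span (insert v B)" by (rule span_add)
      then show "w \<in> span (insert v B)" by (simp add: u_def)
    qed
    moreover have "pairwise orthogonal (insert v B)"
      using B(1,2) by (auto simp: pairwise_insert U_def orthogonal_def inner_commute)
    ultimately show ?thesis
      using B v by (intro exI[of _ "insert v B"]) (auto simp: U_def)
  qed
qed

section \<open>Spectral decomposition in an orthogonal frame\<close>

definition conj_diag :: "real^'n^'n \<Rightarrow> ('n \<Rightarrow> real) \<Rightarrow> real^'n^'n" where
  "conj_diag Q d = Q ** (\<chi> i j. if i = j then d i else 0) ** transpose Q"

theorem sym_mat_conj_diag:
  fixes A :: "real^'n^'n"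
  assumes "sym_mat A"
  obtains Q d where "orthogonal_matrix Q" "A = conj_diag Q d"
proof -
  obtain B where B: "pairwise orthogonal B" "\<And>b. b \<in> B \<Longrightarrow> norm b = 1" "span B = UNIV"
      "\<And>b. b \<in> B \<Longrightarrow> \<exists>c. A *v b = c *\<^sub>R b"
    using sym_mat_eigenbasis_of_subspace[OF assms, of UNIV] by (auto simp: top_unique)
  have "0 \<notin> B" using B(2) by force
  then have indep: "independent B" using B(1) by (simp add: pairwise_orthogonal_independent)
  have "card B = dim (span B)" using indep by (simp add: dim_eq_card_independent)
  then have "card B = CARD('n)" by (simp add: B(3))
  then obtain f where f: "bij_betw f (UNIV::'n set) B"
    using indep by (metis finite_same_card_bij finite finiteI_independent)
  have "\<forall>i. \<exists>c. A *v f i = c *\<^sub>R f i"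
    using B(4) f by (auto simp: bij_betw_def)
  then obtain d where d: "\<And>i. A *v f i = d i *\<^sub>R f i"
    using choice[of "\<lambda>i c. A *v f i = c *\<^sub>R f i"] by blast
  define Q :: "real^'n^'n" where "Q = (\<chi> i j. f j $ i)"
  have colQ: "column j Q = f j" for j by (simp add: column_def Q_def)
  have orth: "orthogonal_matrix Q"
    unfolding orthogonal_matrix_orthonormal_columns colQ
    using f B(1,2) by (auto simp: bij_betw_def inj_eq pairwise_def)
  have "A ** Q = Q ** (\<chi> i j. if i = j then d i else 0)"
  proof -
    have "(A ** Q) $ i $ j = (A *v f j) $ i" for i j
      by (simp add: matrix_matrix_mult_def matrix_vector_mult_def Q_def)
    moreover have "(Q ** (\<chi> i j. if i = j then d i else 0)) $ i $ j = d j * f j $ i" for i j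
      by (simp add: matrix_matrix_mult_def Q_def if_distrib cong: if_cong)
    ultimately show ?thesis by (simp add: vec_eq_iff d)
  qed
  then have "A ** (Q ** transpose Q) = conj_diag Q d" by (simp add: conj_diag_def matrix_mul_assoc)
  then have "A = conj_diag Q d" using orth by (simp add: orthogonal_matrix_def)
  with orth show thesis by (rule that)
qed

text \<open>Orthogonality cancels the inner Q^T Q. Together with the rules for sums and multiples,
  this reduces identities between matrices with a common frame Q to scalar identities between
  eigenvalues.\<close>

lemma conj_diag_mult:
  fixes Q :: "real^'n^'n"
  assumes "orthogonal_matrix Q"
  shows "conj_diag Q d ** conj_diag Q e = conj_diag Q (\<lambda>i. d i * e i)"
proof -
  have "(\<chi> i j. if i = j then d i else 0) ** (\<chi> i j. if i = j then e i else 0)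
     = ((\<chi> i j. if i = j then d i * e i else 0) :: real^'n^'n)"
    by (simp add: matrix_matrix_mult_def vec_eq_iff if_distrib[where f="\<lambda>x. x * _"] cong: if_cong)
  moreover have "conj_diag Q d ** conj_diag Q e =
     Q ** (\<chi> i j. if i = j then d i else 0) ** (transpose Q ** Q) ** (\<chi> i j. if i = j then e i else 0) ** transpose Q"
    by (simp add: conj_diag_def matrix_mul_assoc)
  ultimately show ?thesis
    using assms by (simp add: conj_diag_def orthogonal_matrix_def matrix_mul_assoc[symmetric])
      (simp add: matrix_mul_assoc)
qed

lemma conj_diag_nth: "conj_diag Q d $ i $ j = (\<Sum>k\<in>UNIV. d k * Q $ i $ k * Q $ j $ k)"
  by (simp add: conj_diag_def matrix_matrix_mult_def transpose_def if_distrib mult_ac cong: if_cong)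

lemma conj_diag_add: "conj_diag Q d + conj_diag Q e = conj_diag Q (\<lambda>i. d i + e i)"
  by (simp add: vec_eq_iff conj_diag_nth sum.distrib algebra_simps)

lemma conj_diag_scaleR: "c *\<^sub>R conj_diag Q d = conj_diag Q (\<lambda>i. c * d i)"
  by (simp add: vec_eq_iff conj_diag_nth sum_distrib_left algebra_simps)

lemma conj_diag_one: "orthogonal_matrix Q \<Longrightarrow> mat 1 = conj_diag Q (\<lambda>i. 1)"
  by (simp add: conj_diag_def orthogonal_matrix_def flip: mat_def)

lemma sym_mat_conj_diag_iff [simp]: "sym_mat (conj_diag Q d)"
  by (simp add: sym_mat_def vec_eq_iff transpose_def conj_diag_nth mult_ac)

lemma det_conj_diag:
  assumes "orthogonal_matrix Q" shows "det (conj_diag Q d) = (\<Prod>i\<in>UNIV. d i)"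
proof -
  have "det Q * det Q = 1" using det_orthogonal_matrix[OF assms] by auto
  then show ?thesis by (simp add: conj_diag_def det_mul det_transpose det_diagonal mult_ac)
qed

lemma trace_conj_diag:
  assumes "orthogonal_matrix Q" shows "trace (conj_diag Q d) = (\<Sum>i\<in>UNIV. d i)"
proof -
  have "trace (conj_diag Q d) = trace ((transpose Q ** Q) ** (\<chi> i j. if i = j then d i else 0))"
    unfolding conj_diag_def by (subst trace_mul_sym) (simp add: matrix_mul_assoc)
  then show ?thesis using assms by (simp add: orthogonal_matrix_def) (simp add: trace_def)
qed

lemma inner_conj_diag:
  "x \<bullet> (conj_diag Q d *v x) = (\<Sum>i\<in>UNIV. d i * ((transpose Q *v x) $ i)\<^sup>2)"
proof -
  let ?y = "transpose Q *v x"
  have "x \<bullet> (conj_diag Q d *v x) = ?y \<bullet> ((\<chi> i j. if i = j then d i else 0) *v ?y)"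
    unfolding conj_diag_def
    by (simp only: matrix_vector_mul_assoc[symmetric] inner_matrix_vector_transpose[of x Q])
  also have "\<dots> = (\<Sum>i\<in>UNIV. d i * (?y $ i)\<^sup>2)"
    unfolding inner_vec_def
    by (intro sum.cong refl)
      (simp add: matrix_vector_mult_def if_distrib[where f="\<lambda>x. x * _"] power2_eq_square cong: if_cong
        del: transpose_matrix_vector)
  finally show ?thesis .
qed

lemma conj_diag_eigenvalue:
  assumes "orthogonal_matrix Q"
  shows "conj_diag Q d *v column i Q = d i *\<^sub>R column i Q"
    and "column i Q \<bullet> (conj_diag Q d *v column i Q) = d i"
    and "column i Q \<noteq> 0"
proof -
  have n1: "norm (column i Q) = 1" using assms by (simp add: orthogonal_matrix_orthonormal_columns)
  have t: "transpose Q *v column i Q = axis i 1"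
  proof -
    have "transpose Q *v column i Q = (transpose Q ** Q) *v axis i 1"
      by (simp only: matrix_vector_mul_assoc[symmetric] matrix_vector_mult_basis[of Q])
    then show ?thesis using assms by (simp add: orthogonal_matrix_def)
  qed
  have D: "(\<chi> i j. if i = j then d i else 0) *v axis i 1 = (d i *\<^sub>R axis i 1 :: real^'a)"
    by (simp add: vec_eq_iff matrix_vector_mult_def axis_def if_distrib[where f="\<lambda>x. x * _"] cong: if_cong)
  show 1: "conj_diag Q d *v column i Q = d i *\<^sub>R column i Q"
    unfolding conj_diag_def
    by (simp only: matrix_vector_mul_assoc[symmetric] t D matrix_vector_mult_scaleR matrix_vector_mult_basis[of Q])
  show "column i Q \<bullet> (conj_diag Q d *v column i Q) = d i" "column i Q \<noteq> 0"
    using n1 by (auto simp: 1 norm_eq_1)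
qed

lemma spd_conj_diag_iff:
  assumes "orthogonal_matrix Q" shows "spd_mat (conj_diag Q d) \<longleftrightarrow> (\<forall>i. 0 < d i)"
proof
  assume "spd_mat (conj_diag Q d)"
  then show "\<forall>i. 0 < d i" using conj_diag_eigenvalue[OF assms] by (metis spd_mat_def)
next
  assume d: "\<forall>i. 0 < d i"
  have "0 < x \<bullet> (conj_diag Q d *v x)" if "x \<noteq> 0" for x
  proof -
    have "transpose Q *v x \<noteq> 0"
    proof
      assume "transpose Q *v x = 0"
      then have "(Q ** transpose Q) *v x = 0" by (simp only: matrix_vector_mul_assoc[symmetric]) simp
      then show False using assms that by (simp add: orthogonal_matrix_def)
    qed
    then obtain i where "(transpose Q *v x) $ i \<noteq> 0" by (auto simp: vec_eq_iff)
    then show ?thesis unfolding inner_conj_diag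
      using d by (intro sum_pos2[of _ i]) (auto simp: less_imp_le simp del: transpose_matrix_vector)
  qed
  then show "spd_mat (conj_diag Q d)" by (simp add: spd_mat_def)
qed

section \<open>Positive square roots and log-determinants\<close>

lemma psd_conj_diag:
  assumes "\<And>i. 0 \<le> d i" shows "psd_mat (conj_diag Q d)"
  unfolding psd_mat_def inner_conj_diag using assms by (auto intro!: sum_nonneg)

text \<open>T is tested on an eigenvector v of S with eigenvalue d. As T^2 v = d^2 v, the vector w =
  T v - d v satisfies T w = - d w, which positivity of T excludes for d > 0 unless w = 0; for d = 0,
  |T v|^2 = v . T^2 v = 0. This gives the definite description in \<open>psd_sqrt\<close> its
  meaning.\<close>

lemma psd_sqrt_unique:
  fixes S T :: "real^'n^'n"
  assumes S: "psd_mat S" and T: "psd_mat T" and eq: "S ** S = T ** T"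
  shows "S = T"
proof -
  obtain Q d where Q: "orthogonal_matrix Q" "S = conj_diag Q d"
    using S sym_mat_conj_diag by (metis psd_mat_def)
  have symT: "sym_mat T" and posT: "\<And>x. 0 \<le> x \<bullet> (T *v x)" using T by (auto simp: psd_mat_def)
  have "T *v column i Q = S *v column i Q" for i
  proof -
    let ?v = "column i Q"
    have Sv: "S *v ?v = d i *\<^sub>R ?v" and di: "?v \<bullet> (S *v ?v) = d i"
      using conj_diag_eigenvalue[OF Q(1)] Q(2) by auto
    have d0: "0 \<le> d i" using di S by (metis psd_mat_def)
    have TT: "T *v (T *v ?v) = (d i)\<^sup>2 *\<^sub>R ?v"
      using eq by (metis Sv matrix_vector_mul_assoc matrix_vector_mult_scaleR power2_eq_square scaleR_scaleR)
    define w where "w = T *v ?v - d i *\<^sub>R ?v"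
    have Tw: "T *v w = - d i *\<^sub>R w"
      by (simp add: w_def matrix_vector_mult_diff_distrib TT matrix_vector_mult_scaleR algebra_simps power2_eq_square)
    have "w = 0"
    proof (cases "d i = 0")
      case True
      then have "w \<bullet> w = 0" using TT by (simp add: w_def sym_mat_inner[OF symT, symmetric])
      then show ?thesis by simp
    next
      case False
      have "0 \<le> - d i * (w \<bullet> w)" using posT[of w] Tw by simp
      then show ?thesis using d0 False
        by (metis inner_eq_zero_iff inner_ge_zero mult_minus_left mult_nonneg_nonneg neg_0_le_iff_le
            order_antisym mult_eq_0_iff)
    qed
    then show ?thesis by (simp add: w_def Sv)
  qed
  then have "T ** Q = S ** Q"
    by (simp add: vec_eq_iff matrix_matrix_mult_def matrix_vector_mult_def column_def)
  then have "T ** (Q ** transpose Q) = S ** (Q ** transpose Q)" by (simp add: matrix_mul_assoc)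
  then show ?thesis using Q(1) by (simp add: orthogonal_matrix_def)
qed

lemma psd_sqrt_eq: "psd_mat S \<Longrightarrow> S ** S = A \<Longrightarrow> psd_sqrt A = S"
  unfolding psd_sqrt_def by (rule the_equality) (auto intro: psd_sqrt_unique)

lemma spd_mat_det_pos:
  fixes A :: "real^'n^'n" assumes "spd_mat A" shows "det A > 0"
proof -
  obtain Q d where Q: "orthogonal_matrix Q" "A = conj_diag Q d"
    using assms sym_mat_conj_diag by (metis spd_mat_def)
  then show ?thesis using assms by (simp add: spd_conj_diag_iff det_conj_diag prod_pos)
qed

lemma spd_mat_sqrt:
  fixes A :: "real^'n^'n"
  assumes "spd_mat A" obtains R where "spd_mat R" "R ** R = A"
proof -
  obtain Q d where Q: "orthogonal_matrix Q" "A = conj_diag Q d"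
    using assms sym_mat_conj_diag by (metis spd_mat_def)
  have d: "\<forall>i. 0 < d i" using assms Q by (simp add: spd_conj_diag_iff)
  show thesis
    by (rule that[of "conj_diag Q (\<lambda>i. sqrt (d i))"])
      (use Q d in \<open>auto simp: spd_conj_diag_iff conj_diag_mult less_imp_le\<close>)
qed

text \<open>Summing ln t <= t - 1 over the eigenvalues; this is the tangent inequality of the
  concave function ln det at the identity.\<close>

lemma ln_det_le_trace:
  fixes M :: "real^'n^'n"
  assumes "spd_mat M" shows "ln (det M) \<le> trace M - real CARD('n)"
proof -
  obtain Q d where Q: "orthogonal_matrix Q" "M = conj_diag Q d"
    using assms sym_mat_conj_diag by (metis spd_mat_def)
  have d: "\<And>i. 0 < d i" using assms Q by (simp add: spd_conj_diag_iff)
  have "ln (det M) = (\<Sum>i\<in>UNIV. ln (d i))"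
    using d by (simp add: Q det_conj_diag ln_prod less_imp_neq[THEN not_sym])
  also have "\<dots> \<le> (\<Sum>i\<in>UNIV. d i - 1)"
    by (intro sum_mono ln_le_minus_one d)
  finally show ?thesis using Q by (simp add: trace_conj_diag sum_subtractf)
qed

lemma spd_mat_congruence:
  fixes P M :: "real^'n^'n"
  assumes P: "spd_mat P" and M: "det M \<noteq> 0"
  shows "spd_mat (M ** P ** transpose M)"
proof -
  have inj: "transpose M *v x \<noteq> 0" if "x \<noteq> 0" for x
  proof
    assume 0: "transpose M *v x = 0"
    have "invertible (transpose M)" using M by (simp add: invertible_det_nz det_transpose)
    then obtain N where "N ** transpose M = mat 1" by (auto simp: invertible_def)
    then have "x = N *v (transpose M *v x)" by (simp only: matrix_vector_mul_assoc matrix_vector_mul_lid)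
    then show False using that 0 by simp
  qed
  have "x \<bullet> ((M ** P ** transpose M) *v x) = (transpose M *v x) \<bullet> (P *v (transpose M *v x))" for x
    by (simp only: matrix_vector_mul_assoc[symmetric] inner_matrix_vector_transpose[of x M])
  then show ?thesis using P inj
    by (auto simp: spd_mat_def sym_mat_def matrix_transpose_mul matrix_mul_assoc simp del: transpose_matrix_vector)
qed

lemma spd_mat_one: "spd_mat (mat 1)"
  by (auto simp: spd_mat_def sym_mat_def)

lemma spd_mat_mult_transpose:
  fixes M :: "real^'n^'n" assumes "det M \<noteq> 0" shows "spd_mat (M ** transpose M)"
  using spd_mat_congruence[OF spd_mat_one assms] by simp

text \<open>The product of two positive definite matrices is similar to a positive definite one.\<close>
lemma ln_det_mult_le_trace:
  fixes P R :: "real^'n^'n"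
  assumes "spd_mat P" "spd_mat R"
  shows "ln (det (P ** R)) \<le> trace (P ** R) - real CARD('n)"
proof -
  obtain T where T: "spd_mat T" "T ** T = P" using spd_mat_sqrt[OF assms(1)] .
  have tT: "transpose T = T" using T by (simp add: spd_mat_def sym_mat_def)
  have "spd_mat (T ** R ** T)"
    using spd_mat_congruence[OF assms(2), of T] spd_mat_det_pos[OF T(1)] tT by simp
  moreover have "det (T ** R ** T) = det (P ** R)"
    by (simp add: T(2)[symmetric] det_mul)
  moreover have "trace (T ** R ** T) = trace (P ** R)"
    by (subst trace_mul_sym) (simp add: T(2)[symmetric] matrix_mul_assoc)
  ultimately show ?thesis using ln_det_le_trace by metis
qed

section \<open>Frobenius inner product and polar decomposition\<close>

lemma inner_matrix_trace: "A \<bullet> B = trace (transpose A ** B)" for A B :: "real^'n^'n"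
  unfolding inner_vec_def trace_def matrix_matrix_mult_def transpose_def
  by simp (rule sum.swap)

lemma inner_matrix_mult_left: "(M ** A) \<bullet> B = A \<bullet> (transpose M ** B)" for A B M :: "real^'n^'n"
  by (simp add: inner_matrix_trace matrix_transpose_mul matrix_mul_assoc)

lemma inner_transpose: "transpose A \<bullet> transpose B = A \<bullet> B" for A B :: "real^'n^'n"
  unfolding inner_vec_def transpose_def by simp (rule sum.swap)

lemma norm_mult_orthogonal:
  fixes R U :: "real^'n^'n"
  assumes "orthogonal_matrix U" shows "norm (R ** U) = norm R"
proof -
  have "(R ** U) \<bullet> (R ** U) = (transpose U ** transpose R) \<bullet> (transpose U ** transpose R)"
    by (metis inner_transpose matrix_transpose_mul)
  also have "\<dots> = transpose R \<bullet> (U ** transpose U ** transpose R)"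
    by (simp add: inner_matrix_mult_left matrix_mul_assoc)
  also have "\<dots> = R \<bullet> R" using assms by (simp add: orthogonal_matrix_def inner_transpose)
  finally show ?thesis by (simp add: norm_eq_sqrt_inner)
qed

text \<open>As in the orthogonal Procrustes problem, U comes from the polar decomposition A^T B = P
  U^T with P = (A^T B B^T A)^(1/2). Then A^T B U = P, and the inequality is tr (P U^T) <= tr
  P.\<close>

lemma polar_alignment:
  fixes A B :: "real^'n^'n"
  assumes "det A \<noteq> 0" "det B \<noteq> 0"
  obtains U where "orthogonal_matrix U" "spd_mat (transpose A ** (B ** U))"
    "A \<bullet> B \<le> A \<bullet> (B ** U)"
proof -
  define M where "M = transpose A ** B"
  have dM: "det M \<noteq> 0" using assms by (simp add: M_def det_mul det_transpose)
  obtain P where P: "spd_mat P" "P ** P = M ** transpose M"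
    using spd_mat_sqrt[OF spd_mat_mult_transpose[OF dM]] .
  have tP: "transpose P = P" using P by (simp add: spd_mat_def sym_mat_def)
  have "invertible P" using spd_mat_det_pos[OF P(1)] by (simp add: invertible_det_nz)
  then obtain N where N: "N ** P = mat 1" "P ** N = mat 1" by (auto simp: invertible_def)
  have tN: "transpose N ** P = mat 1"
    using N(2) tP by (metis matrix_transpose_mul transpose_mat)
  define U where "U = transpose M ** N"
  have MU: "M ** U = P"
    by (metis N(2) P(2) U_def matrix_mul_assoc matrix_mul_rid)
  have "transpose U ** U = transpose N ** (M ** transpose M) ** N"
    by (simp add: U_def matrix_transpose_mul matrix_mul_assoc)
  also have "\<dots> = (transpose N ** P) ** (P ** N)" by (simp add: P(2)[symmetric] matrix_mul_assoc)
  finally have oU: "orthogonal_matrix U" by (simp add: N tN orthogonal_matrix)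
  have "M = P ** transpose U"
    by (metis MU oU matrix_mul_assoc matrix_mul_rid orthogonal_matrix_def)
  \<comment> \<open>Splitting P as R R turns tr (P U^T) into the inner product of R with R U^T.
    These have equal norm, so Cauchy-Schwarz bounds it by |R|^2 = tr P.\<close>
  obtain R where R: "spd_mat R" "R ** R = P" using spd_mat_sqrt[OF P(1)] .
  have tR: "transpose R = R" using R by (simp add: spd_mat_def sym_mat_def)
  have "A \<bullet> B = trace M" by (simp add: inner_matrix_trace M_def)
  also have "\<dots> = R \<bullet> (R ** transpose U)"
    by (simp add: \<open>M = P ** transpose U\<close> inner_matrix_trace R(2)[symmetric] tR matrix_mul_assoc)
  also have "\<dots> \<le> norm R * norm (R ** transpose U)" by (rule norm_cauchy_schwarz)
  also have "\<dots> = R \<bullet> R" using oU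
    by (simp add: norm_mult_orthogonal flip: power2_eq_square power2_norm_eq_inner)
  also have "\<dots> = trace P" by (simp add: inner_matrix_trace tR R(2))
  also have "\<dots> = A \<bullet> (B ** U)" by (simp add: inner_matrix_trace MU[symmetric] M_def matrix_mul_assoc)
  finally have "A \<bullet> B \<le> A \<bullet> (B ** U)" .
  moreover have "spd_mat (transpose A ** (B ** U))" using P(1) MU by (simp add: M_def matrix_mul_assoc)
  ultimately show thesis using oU by (intro that)
qed

section \<open>Lebesgue measure under linear maps\<close>

lemma lborel_nn_integral_translate:
  fixes f :: "'a::euclidean_space \<Rightarrow> ennreal"
  assumes [measurable]: "f \<in> borel_measurable borel"
  shows "(\<integral>\<^sup>+x. f (a + x) \<partial>lborel) = (\<integral>\<^sup>+x. f x \<partial>lborel)"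
proof -
  have "(\<integral>\<^sup>+x. f x \<partial>distr lborel borel ((+) a)) = (\<integral>\<^sup>+x. f (a + x) \<partial>lborel)"
    by (rule nn_integral_distr) simp_all
  then show ?thesis by (simp only: lborel_distr_plus)
qed

lemma lborel_nn_integral_uminus:
  fixes f :: "'a::euclidean_space \<Rightarrow> ennreal"
  assumes [measurable]: "f \<in> borel_measurable borel"
  shows "(\<integral>\<^sup>+x. f (- x) \<partial>lborel) = (\<integral>\<^sup>+x. f x \<partial>lborel)"
proof -
  have "(\<integral>\<^sup>+x. f x \<partial>distr lborel borel uminus) = (\<integral>\<^sup>+x. f (- x) \<partial>lborel)"
    by (rule nn_integral_distr) simp_all
  moreover have "lborel = distr lborel borel (uminus :: 'a \<Rightarrow> 'a)"
    using lborel_affine[of "-1" "0::'a"] by (simp add: density_1)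
  ultimately show ?thesis by metis
qed

text \<open>Weil's uniqueness argument for Haar measure.\<close>
lemma translation_invariant_nn_integral_swap:
  fixes f g :: "'a::euclidean_space \<Rightarrow> ennreal"
  assumes "sigma_finite_measure N" and sets [measurable_cong]: "sets N = sets borel"
    and inv: "\<And>h a. h \<in> borel_measurable borel \<Longrightarrow> (\<integral>\<^sup>+x. h (a + x) \<partial>N) = (\<integral>\<^sup>+x. h x \<partial>N)"
    and [measurable]: "f \<in> borel_measurable borel" "g \<in> borel_measurable borel"
  shows "(\<integral>\<^sup>+x. f x \<partial>lborel) * (\<integral>\<^sup>+y. g y \<partial>N) = (\<integral>\<^sup>+x. f x \<partial>N) * (\<integral>\<^sup>+y. g y \<partial>lborel)"
proof -
  interpret N: sigma_finite_measure N by fact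
  interpret P: pair_sigma_finite lborel N ..
  have "(\<integral>\<^sup>+x. f x \<partial>lborel) * (\<integral>\<^sup>+y. g y \<partial>N) = (\<integral>\<^sup>+y. (\<integral>\<^sup>+x. f x \<partial>lborel) * g y \<partial>N)"
    by (simp add: nn_integral_cmult)
  also have "\<dots> = (\<integral>\<^sup>+y. (\<integral>\<^sup>+x. f (y + x) * g y \<partial>lborel) \<partial>N)"
    by (simp add: nn_integral_multc lborel_nn_integral_translate)
  also have "\<dots> = (\<integral>\<^sup>+x. (\<integral>\<^sup>+y. f (y + x) * g y \<partial>N) \<partial>lborel)"
    by (rule P.Fubini') measurable
  \<comment> \<open>Invariance of N under translation by x. Afterwards x occurs only in g (y - x),
    whose Lebesgue integral over x does not depend on y.\<close>
  also have "\<dots> = (\<integral>\<^sup>+x. (\<integral>\<^sup>+y. f y * g (y - x) \<partial>N) \<partial>lborel)"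
  proof (rule nn_integral_cong)
    fix x :: 'a
    have "(\<integral>\<^sup>+y. (\<lambda>y. f y * g (y - x)) (x + y) \<partial>N) = (\<integral>\<^sup>+y. f y * g (y - x) \<partial>N)"
      by (rule inv) measurable
    then show "(\<integral>\<^sup>+y. f (y + x) * g y \<partial>N) = (\<integral>\<^sup>+y. f y * g (y - x) \<partial>N)"
      by (simp add: add.commute)
  qed
  also have "\<dots> = (\<integral>\<^sup>+y. (\<integral>\<^sup>+x. f y * g (y - x) \<partial>lborel) \<partial>N)"
    by (rule P.Fubini'[symmetric]) measurable
  also have "\<dots> = (\<integral>\<^sup>+y. f y * (\<integral>\<^sup>+x. g (y - x) \<partial>lborel) \<partial>N)"
    by (simp add: nn_integral_cmult)
  also have "\<dots> = (\<integral>\<^sup>+y. f y * (\<integral>\<^sup>+x. g x \<partial>lborel) \<partial>N)"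
  proof -
    have "(\<integral>\<^sup>+x. g (y - x) \<partial>lborel) = (\<integral>\<^sup>+x. g x \<partial>lborel)" for y
      using lborel_nn_integral_uminus[of "\<lambda>x. g (y + x)"] lborel_nn_integral_translate[of g y] by simp
    then show ?thesis by simp
  qed
  also have "\<dots> = (\<integral>\<^sup>+x. f x \<partial>N) * (\<integral>\<^sup>+y. g y \<partial>lborel)"
    by (simp add: nn_integral_multc)
  finally show ?thesis .
qed

lemma orthogonal_matrix_norm:
  fixes U :: "real^'n^'n" assumes "orthogonal_matrix U" shows "norm (U *v x) = norm x"
proof -
  have "(U *v x) \<bullet> (U *v x) = (transpose U ** U *v x) \<bullet> x"
    by (simp only: inner_matrix_vector_transpose matrix_vector_mul_assoc)
  then show ?thesis using assms by (simp add: orthogonal_matrix_def norm_eq_sqrt_inner)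
qed

lemma matrix_vector_mult_measurable [measurable]:
  assumes "f \<in> borel_measurable M"
  shows "(\<lambda>x. (A::real^'n^'m) *v f x) \<in> borel_measurable M"
  using assms by (rule measurable_compose) (intro borel_measurable_continuous_onI continuous_intros)

text \<open>The identity U (U^T a + x) = a + U x makes the image measure translation invariant,
  hence proportional to Lebesgue measure. Balls about the origin are preserved, so the factor is
  1.\<close>

lemma lborel_distr_orthogonal:
  fixes U :: "real^'n^'n" assumes U: "orthogonal_matrix U"
  shows "distr lborel borel ((*v) U) = lborel"
proof -
  define N where "N = distr lborel borel ((*v) U)"
  have sN [measurable_cong]: "sets N = sets borel" by (simp add: N_def)
  have [simp]: "U *v (transpose U *v y) = y" for y
    using U by (simp only: matrix_vector_mul_assoc orthogonal_matrix_def matrix_vector_mul_lid)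
  have N: "(\<integral>\<^sup>+x. h x \<partial>N) = (\<integral>\<^sup>+x. h (U *v x) \<partial>lborel)" if "h \<in> borel_measurable borel" for h
    unfolding N_def using that by (simp add: nn_integral_distr)
  have preball: "(*v) U -` ball 0 r = ball 0 r" for r
    using orthogonal_matrix_norm[OF U] by auto
  have ballN: "emeasure N (ball 0 r) = emeasure lborel (ball (0::real^'n) r)" for r
    unfolding N_def by (subst emeasure_distr) (auto simp: preball)
  have "sigma_finite_measure N"
  proof
    show "\<exists>A. countable A \<and> A \<subseteq> sets N \<and> \<Union>A = space N \<and> (\<forall>a\<in>A. emeasure N a \<noteq> \<infinity>)"
    proof (intro exI conjI)
      show "countable (range (\<lambda>k::nat. ball (0::real^'n) (real k)))" by simp
      show "range (\<lambda>k::nat. ball (0::real^'n) (real k)) \<subseteq> sets N" by (auto simp: sN)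
      show "\<Union>(range (\<lambda>k::nat. ball (0::real^'n) (real k))) = space N"
        by (auto simp: N_def reals_Archimedean2)
      show "\<forall>a\<in>range (\<lambda>k::nat. ball (0::real^'n) (real k)). emeasure N a \<noteq> \<infinity>"
        using emeasure_lborel_ball_finite by (auto simp: ballN less_top)
    qed
  qed
  moreover have "(\<integral>\<^sup>+x. h (a + x) \<partial>N) = (\<integral>\<^sup>+x. h x \<partial>N)" if [measurable]: "h \<in> borel_measurable borel" for h a
  proof -
    have "(\<integral>\<^sup>+x. h (a + x) \<partial>N) = (\<integral>\<^sup>+x. h (U *v (transpose U *v a + x)) \<partial>lborel)"
      by (simp add: N matrix_vector_right_distrib del: transpose_matrix_vector)
    also have "\<dots> = (\<integral>\<^sup>+x. h (U *v x) \<partial>lborel)"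
      by (rule lborel_nn_integral_translate) measurable
    finally show ?thesis by (simp add: N)
  qed
  ultimately have swap: "(\<integral>\<^sup>+x. f x \<partial>lborel) * (\<integral>\<^sup>+y. g y \<partial>N) = (\<integral>\<^sup>+x. f x \<partial>N) * (\<integral>\<^sup>+y. g y \<partial>lborel)"
    if "f \<in> borel_measurable borel" "g \<in> borel_measurable borel" for f g
    using translation_invariant_nn_integral_swap[OF _ sN] that by blast
  have "N = lborel"
  proof (rule measure_eqI)
    fix X assume "X \<in> sets N"
    then have X: "X \<in> sets borel" by (simp add: sN)
    let ?b = "emeasure lborel (ball (0::real^'n) 1)"
    have b: "?b \<noteq> 0" "?b \<noteq> \<infinity>"
      using emeasure_lborel_ball_finite[of "0::real^'n" 1] content_ball_pos[of 1 "0::real^'n"]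
      by (auto simp: measure_def)
    have ind: "(indicator (ball 0 1) :: real^'n \<Rightarrow> ennreal) \<in> borel_measurable borel"
      by (intro borel_measurable_indicator) simp
    have "emeasure lborel X * ?b = emeasure N X * ?b"
      using swap[OF _ ind, of "indicator X"] X by (simp add: sN ballN)
    then show "emeasure N X = emeasure lborel X" using b by (simp add: ennreal_mult_cancel_left mult.commute[of _ ?b])
  qed (simp add: sN)
  then show ?thesis by (simp add: N_def)
qed

section \<open>Invertible linear changes of variables\<close>

lemma Basis_vec_real: "(Basis :: (real^'n) set) = range (\<lambda>i. axis i 1)"
  by (auto simp: Basis_vec_def)

lemma prod_Basis_vec: "(\<Prod>b\<in>(Basis :: (real^'n) set). f b) = (\<Prod>i\<in>UNIV. f (axis i 1))"
  unfolding Basis_vec_real by (subst prod.reindex) (auto simp: inj_on_def axis_eq_axis)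

lemma sum_Basis_vec: "(\<Sum>b\<in>(Basis :: (real^'n) set). f b) = (\<Sum>i\<in>UNIV. f (axis i 1))"
  unfolding Basis_vec_real by (subst sum.reindex) (auto simp: inj_on_def axis_eq_axis)

lemma lborel_nn_integral_orthogonal:
  fixes U :: "real^'n^'n"
  assumes "orthogonal_matrix U" and [measurable]: "f \<in> borel_measurable borel"
  shows "(\<integral>\<^sup>+x. f (U *v x) \<partial>lborel) = (\<integral>\<^sup>+x. f x \<partial>lborel)"
proof -
  have "(\<integral>\<^sup>+x. f x \<partial>distr lborel borel ((*v) U)) = (\<integral>\<^sup>+x. f (U *v x) \<partial>lborel)"
    by (rule nn_integral_distr) simp_all
  then show ?thesis by (simp only: lborel_distr_orthogonal[OF assms(1)])
qed

lemma lborel_nn_integral_diag: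
  fixes d :: "'n::finite \<Rightarrow> real" and f :: "real^'n \<Rightarrow> ennreal"
  assumes d: "\<And>i. d i \<noteq> 0" and [measurable]: "f \<in> borel_measurable borel"
  shows "(\<integral>\<^sup>+x. f x \<partial>lborel)
    = ennreal \<bar>\<Prod>i\<in>UNIV. d i\<bar> * (\<integral>\<^sup>+x. f ((\<chi> i j. if i = j then d i else 0) *v x) \<partial>lborel)"
proof -
  define c where "c b = (\<Sum>i\<in>UNIV. d i * (b $ i))" for b :: "real^'n"
  have c: "c (axis i 1) = d i" for i by (simp add: c_def axis_def if_distrib cong: if_cong)
  have cB: "c j \<noteq> 0" if "j \<in> Basis" for j using that d c by (auto simp: Basis_vec_real)
  have T: "0 + (\<Sum>j\<in>Basis. (c j * (x \<bullet> j)) *\<^sub>R j) = (\<chi> i j. if i = j then d i else 0) *v x" for x :: "real^'n"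
    unfolding sum_Basis_vec c inner_axis
    by (simp add: vec_eq_iff matrix_vector_mult_def axis_def
        if_distrib[where f="\<lambda>x. x * _"] if_distrib[where f="\<lambda>x. _ * x"] cong: if_cong)
  have P: "(\<Prod>j\<in>Basis. \<bar>c j\<bar>) = \<bar>\<Prod>i\<in>UNIV. d i\<bar>"
    by (simp add: prod_Basis_vec c abs_prod)
  have "(\<integral>\<^sup>+x. f x \<partial>lborel) = (\<integral>\<^sup>+x. f x \<partial>density (distr lborel borel
      (\<lambda>x. 0 + (\<Sum>j\<in>Basis. (c j * (x \<bullet> j)) *\<^sub>R j))) (\<lambda>_. (\<Prod>j\<in>Basis. \<bar>c j\<bar>)))"
    using lborel_affine_euclidean[of c 0] cB by simp
  then show ?thesis unfolding T P
    by (simp add: nn_integral_density nn_integral_distr nn_integral_cmult)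
qed

lemma lborel_nn_integral_linear:
  fixes A :: "real^'n^'n" and f :: "real^'n \<Rightarrow> ennreal"
  assumes A: "det A \<noteq> 0" and [measurable]: "f \<in> borel_measurable borel"
  shows "(\<integral>\<^sup>+x. f x \<partial>lborel) = ennreal \<bar>det A\<bar> * (\<integral>\<^sup>+x. f (A *v x) \<partial>lborel)"
proof -
  \<comment> \<open>Aligning A with the identity makes A U positive definite. Diagonalizing it
    writes A as orthogonal times diagonal times orthogonal; only the diagonal part scales
    volume.\<close>
  obtain U where U: "orthogonal_matrix U" "spd_mat (A ** U)"
    using polar_alignment[of "mat 1" A] A by auto
  obtain Q d where Q: "orthogonal_matrix Q" "A ** U = conj_diag Q d"
    using U sym_mat_conj_diag by (metis spd_mat_def)
  have d: "d i > 0" for i using U Q by (simp add: spd_conj_diag_iff)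
  let ?D = "(\<chi> i j. if i = j then d i else 0) :: real^'n^'n"
  have "A = A ** U ** transpose U" using U by (simp add: matrix_mul_assoc[symmetric] orthogonal_matrix_def)
  also have "\<dots> = Q ** ?D ** (transpose Q ** transpose U)" by (simp add: Q conj_diag_def matrix_mul_assoc)
  finally have A_eq: "A = Q ** ?D ** (transpose Q ** transpose U)" .
  have o: "orthogonal_matrix (transpose Q ** transpose U)"
    using Q U by (intro orthogonal_matrix_mul) auto
  have "\<bar>det Q\<bar> = 1" "\<bar>det (transpose Q ** transpose U)\<bar> = 1"
    using det_orthogonal_matrix[OF Q(1)] det_orthogonal_matrix[OF o] by auto
  then have dA: "\<bar>det A\<bar> = \<bar>\<Prod>i\<in>UNIV. d i\<bar>"
    by (subst A_eq) (simp add: det_mul[of "Q ** ?D"] det_mul[of Q] abs_mult det_diagonal)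
  have "(\<integral>\<^sup>+x. f x \<partial>lborel) = (\<integral>\<^sup>+x. f (Q *v x) \<partial>lborel)"
    by (rule lborel_nn_integral_orthogonal[OF Q(1), symmetric]) simp
  also have "\<dots> = ennreal \<bar>det A\<bar> * (\<integral>\<^sup>+x. f (Q *v (?D *v x)) \<partial>lborel)"
    unfolding dA using d less_imp_neq[OF d]
    by (intro lborel_nn_integral_diag[of d "\<lambda>x. f (Q *v x)"]) auto
  also have "(\<integral>\<^sup>+x. f (Q *v (?D *v x)) \<partial>lborel)
      = (\<integral>\<^sup>+x. f (Q *v (?D *v ((transpose Q ** transpose U) *v x))) \<partial>lborel)"
    by (rule lborel_nn_integral_orthogonal[OF o, of "\<lambda>x. f (Q *v (?D *v x))", symmetric]) simp
  also have "(\<lambda>x. Q *v (?D *v ((transpose Q ** transpose U) *v x))) = (\<lambda>x. A *v x)"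
    by (subst A_eq) (simp only: matrix_vector_mul_assoc matrix_mul_assoc)
  then have "(\<integral>\<^sup>+x. f (Q *v (?D *v ((transpose Q ** transpose U) *v x))) \<partial>lborel) = (\<integral>\<^sup>+x. f (A *v x) \<partial>lborel)"
    by metis
  finally show ?thesis .
qed

section \<open>Gaussian measures\<close>

abbreviation std_gauss :: "(real^'n) measure" where
  "std_gauss \<equiv> gauss 0 (mat 1)"

lemma matrix_inv_unique:
  fixes A B :: "real^'n^'n"
  assumes "A ** B = mat 1" "B ** A = mat 1" shows "matrix_inv A = B"
proof -
  have "A ** matrix_inv A = mat 1 \<and> matrix_inv A ** A = mat 1"
    unfolding matrix_inv_def by (rule someI[of _ B]) (simp add: assms)
  then show ?thesis by (metis assms(2) matrix_mul_assoc matrix_mul_lid matrix_mul_rid)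
qed

lemma matrix_inv_mat_1 [simp]: "matrix_inv (mat 1 :: real^'n^'n) = mat 1"
  by (rule matrix_inv_unique) simp_all

lemma gauss_pdf_std:
  "gauss_pdf 0 (mat 1) x = (\<Prod>b\<in>Basis. std_normal_density (x \<bullet> b))" for x :: "real^'n"
proof -
  have "(\<Prod>b\<in>Basis. std_normal_density (x \<bullet> b))
      = (1 / sqrt (2 * pi)) ^ CARD('n) * exp (\<Sum>b\<in>Basis. - (x \<bullet> b)\<^sup>2 / 2)"
    by (simp add: std_normal_density_def prod.distrib prod_dividef exp_sum power_one_over power_divide)
  also have "(\<Sum>b\<in>Basis. - (x \<bullet> b)\<^sup>2 / 2) = - (x \<bullet> x) / 2"
    by (simp add: euclidean_inner[of x x] power2_eq_square sum_negf sum_divide_distrib)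
  also have "(1 / sqrt (2 * pi)) ^ CARD('n) = (2 * pi) powr (- real CARD('n) / 2)"
    by (simp add: powr_half_sqrt[symmetric] powr_minus_divide[symmetric] powr_realpow[symmetric] powr_powr)
  finally show ?thesis by (simp add: gauss_pdf_def)
qed

lemma gauss_pdf_nonneg: "0 \<le> gauss_pdf m S x"
  by (simp add: gauss_pdf_def)

lemma gauss_pdf_measurable [measurable]: "gauss_pdf m S \<in> borel_measurable borel"
  unfolding gauss_pdf_def by measurable

lemma sets_gauss [simp, measurable_cong]: "sets (gauss m S) = sets borel"
  by (simp add: gauss_def)

lemma space_gauss [simp]: "space (gauss m S) = UNIV"
  by (simp add: gauss_def)

text \<open>Stated for nonnegative integrals, so that the factorization is available before any
  integrability is known.\<close>

lemma nn_integral_std_gauss_prod: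
  assumes [measurable]: "\<And>b. f b \<in> borel_measurable borel" and f: "\<And>b t. 0 \<le> f b t"
  shows "(\<integral>\<^sup>+x. ennreal (\<Prod>b\<in>Basis. f b (x \<bullet> b)) \<partial>(std_gauss :: (real^'n) measure))
    = (\<Prod>b\<in>(Basis::(real^'n) set). \<integral>\<^sup>+t. ennreal (std_normal_density t * f b t) \<partial>lborel)"
proof -
  have "(\<integral>\<^sup>+x. ennreal (\<Prod>b\<in>Basis. f b (x \<bullet> b)) \<partial>(std_gauss :: (real^'n) measure))
     = (\<integral>\<^sup>+x. ennreal (gauss_pdf 0 (mat 1) x) * ennreal (\<Prod>b\<in>Basis. f b (x \<bullet> b)) \<partial>lborel)"
    unfolding gauss_def by (subst nn_integral_density) auto
  also have "\<dots> = (\<integral>\<^sup>+x. (\<Prod>b\<in>(Basis::(real^'n) set). ennreal (std_normal_density (x \<bullet> b) * f b (x \<bullet> b))) \<partial>lborel)"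
    by (intro nn_integral_cong)
      (simp add: gauss_pdf_std prod_ennreal prod_nonneg ennreal_mult'[symmetric] prod.distrib[symmetric] f)
  also have "\<dots> = (\<Prod>b\<in>(Basis::(real^'n) set). \<integral>\<^sup>+t. ennreal (std_normal_density t * f b t) \<partial>lborel)"
    by (rule nn_integral_lborel_prod) auto
  finally show ?thesis .
qed

lemma prob_space_std_gauss: "prob_space (std_gauss :: (real^'n) measure)"
proof
  have "(\<integral>\<^sup>+t. ennreal (std_normal_density t) \<partial>lborel) = 1"
    by (subst nn_integral_eq_integral) auto
  then have "(\<integral>\<^sup>+x. ennreal 1 \<partial>(std_gauss :: (real^'n) measure)) = 1"
    using nn_integral_std_gauss_prod[of "\<lambda>(_::real^'n) _. 1"] by simp
  then show "emeasure std_gauss (space (std_gauss :: (real^'n) measure)) = 1" by simp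
qed

interpretation std_gauss: prob_space "std_gauss :: (real^'n) measure"
  by (rule prob_space_std_gauss)

section \<open>Exponential moments and integrability\<close>

lemma integrable_normal_density_exp:
  "integrable lborel (\<lambda>t. std_normal_density t * exp (c * \<bar>t\<bar>))"
proof -
  \<comment> \<open>Completing the square: the tilted density is a multiple of a normal density
    centred at a. The weight exp (c |t|) is dominated by the sum of two tilts of opposite
    sign.\<close>
  have e: "std_normal_density t * exp (a * t) = exp (a\<^sup>2 / 2) * normal_density a 1 t" for a t :: real
    unfolding normal_density_def
    by (simp add: exp_add[symmetric] power2_eq_square field_simps)
  have i: "integrable lborel (\<lambda>t. std_normal_density t * exp (a * t))" for a
    unfolding e by simp
  have "integrable lborel (\<lambda>t. std_normal_density t * exp (c * t) + std_normal_density t * exp ((-c) * t))"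
    by (intro Bochner_Integration.integrable_add i)
  then show ?thesis
  proof (rule Bochner_Integration.integrable_bound)
    show "AE t in lborel. norm (std_normal_density t * exp (c * \<bar>t\<bar>))
        \<le> norm (std_normal_density t * exp (c * t) + std_normal_density t * exp ((-c) * t))"
    proof (intro AE_I2)
      fix t :: real
      have "0 \<le> std_normal_density t * exp (a * t)" for a by simp
      note nn = this[of c] this[of "-c"]
      have "std_normal_density t * exp (c * \<bar>t\<bar>)
          \<le> std_normal_density t * exp (c * t) + std_normal_density t * exp ((-c) * t)"
        using nn by (cases "t < 0") (simp_all del: zero_le_mult_iff mult_nonneg_nonneg)
      moreover have "0 \<le> std_normal_density t * exp (c * \<bar>t\<bar>)" by simp
      ultimately show "norm (std_normal_density t * exp (c * \<bar>t\<bar>))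
        \<le> norm (std_normal_density t * exp (c * t) + std_normal_density t * exp ((-c) * t))"
        by (simp only: real_norm_def)
    qed
  qed measurable
qed

text \<open>The l1 norm makes the exponential a product over coordinates, and it dominates the
  Euclidean norm.\<close>

lemma integrable_std_gauss_exp_l1:
  "integrable std_gauss (\<lambda>x::real^'n. exp (c * (\<Sum>b\<in>Basis. \<bar>x \<bullet> b\<bar>)))"
proof (rule integrableI_nonneg)
  have "(\<integral>\<^sup>+x. ennreal (exp (c * (\<Sum>b\<in>Basis. \<bar>x \<bullet> b\<bar>))) \<partial>(std_gauss :: (real^'n) measure))
    = (\<integral>\<^sup>+x. ennreal (\<Prod>b\<in>Basis. exp (c * \<bar>x \<bullet> b\<bar>)) \<partial>(std_gauss :: (real^'n) measure))"
    by (simp add: sum_distrib_left exp_sum)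
  also have "\<dots> = (\<Prod>b\<in>(Basis::(real^'n) set). \<integral>\<^sup>+t. ennreal (std_normal_density t * exp (c * \<bar>t\<bar>)) \<partial>lborel)"
    by (rule nn_integral_std_gauss_prod[where f="\<lambda>b t. exp (c * \<bar>t\<bar>)"]) auto
  also have "\<dots> < \<infinity>"
    using integrable_normal_density_exp[of c]
    by (simp add: nn_integral_eq_integral ennreal_power less_top[symmetric])
  finally show "(\<integral>\<^sup>+x. ennreal (exp (c * (\<Sum>b\<in>Basis. \<bar>x \<bullet> b\<bar>))) \<partial>(std_gauss :: (real^'n) measure)) < \<infinity>" .
qed (auto simp: measurable_cong_sets[OF sets_gauss refl])

text \<open>One growth class for everything integrated below: it is stable under sums, products and
  affine substitutions, and its measurable members are Gaussian integrable. It contains V, its first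
  two derivatives and the dominating function in Stein's identity.\<close>

definition exp_growth :: "('a::real_normed_vector \<Rightarrow> 'b::real_normed_vector) \<Rightarrow> bool" where
  "exp_growth f \<longleftrightarrow> (\<exists>K c. 0 \<le> c \<and> (\<forall>x. norm (f x) \<le> K * exp (c * norm x)))"

lemma integrable_std_gauss:
  fixes f :: "real^'n \<Rightarrow> 'b::{banach, second_countable_topology}"
  assumes [measurable]: "f \<in> borel_measurable borel" and "exp_growth f"
  shows "integrable std_gauss f"
proof -
  obtain K c where c: "0 \<le> c" "\<And>x. norm (f x) \<le> K * exp (c * norm x)"
    using assms(2) by (auto simp: exp_growth_def)
  have "0 \<le> K" using order_trans[OF norm_ge_zero c(2)[of 0]] by simp
  have "integrable std_gauss (\<lambda>x::real^'n. K * exp (c * (\<Sum>b\<in>Basis. \<bar>x \<bullet> b\<bar>)))"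
    by (intro integrable_mult_right integrable_std_gauss_exp_l1)
  then show ?thesis
  proof (rule Bochner_Integration.integrable_bound)
    have "norm (f x) \<le> K * exp (c * (\<Sum>b\<in>Basis. \<bar>x \<bullet> b\<bar>))" for x
    proof -
      have "K * exp (c * norm x) \<le> K * exp (c * (\<Sum>b\<in>Basis. \<bar>x \<bullet> b\<bar>))"
        using c(1) \<open>0 \<le> K\<close> norm_le_l1[of x] by (intro mult_left_mono) (auto intro: mult_left_mono)
      with c(2)[of x] show ?thesis by simp
    qed
    then show "AE x in std_gauss. norm (f x) \<le> norm (K * exp (c * (\<Sum>b\<in>Basis. \<bar>x \<bullet> b\<bar>)))"
      using \<open>0 \<le> K\<close> by simp
  qed (simp add: measurable_cong_sets[OF sets_gauss refl])
qed

lemma exp_growth_mono: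
  assumes "exp_growth g" "\<And>x. norm (f x) \<le> norm (g x)" shows "exp_growth f"
  using assms order_trans unfolding exp_growth_def by meson

lemma exp_growth_const: "exp_growth (\<lambda>x. a)"
  unfolding exp_growth_def by (intro exI[of _ "norm a"] exI[of _ 0]) simp

lemma exp_growth_exp: "0 \<le> c \<Longrightarrow> exp_growth (\<lambda>x. exp (c * norm x))"
  unfolding exp_growth_def by (intro exI[of _ 1] exI[of _ c]) simp

lemma exp_growth_norm: "exp_growth (\<lambda>x. norm x)"
proof -
  have "norm x \<le> exp (norm x)" for x :: 'a using exp_ge_add_one_self[of "norm x"] by linarith
  then show ?thesis unfolding exp_growth_def by (intro exI[of _ 1]) auto
qed

lemma exp_growth_ident: "exp_growth (\<lambda>x. x)"
  using exp_growth_norm by (simp add: exp_growth_def)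

lemma exp_growth_add:
  assumes "exp_growth f" "exp_growth g" shows "exp_growth (\<lambda>x. f x + g x)"
proof -
  obtain K c K' c' where c: "0 \<le> c" "\<And>x. norm (f x) \<le> K * exp (c * norm x)"
      "0 \<le> c'" "\<And>x. norm (g x) \<le> K' * exp (c' * norm x)"
    using assms by (auto simp: exp_growth_def)
  have K: "0 \<le> K" "0 \<le> K'"
    using order_trans[OF norm_ge_zero c(2)[of 0]] order_trans[OF norm_ge_zero c(4)[of 0]] by simp_all
  have "norm (f x + g x) \<le> (K + K') * exp ((c + c') * norm x)" for x
  proof -
    have "K * exp (c * norm x) \<le> K * exp ((c + c') * norm x)"
      "K' * exp (c' * norm x) \<le> K' * exp ((c + c') * norm x)"
      using K c by (auto intro!: mult_left_mono mult_right_mono)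
    then show ?thesis using c(2)[of x] c(4)[of x] norm_triangle_ineq[of "f x" "g x"]
      by (simp add: algebra_simps)
  qed
  then show ?thesis unfolding exp_growth_def using c by (intro exI[of _ "K + K'"] exI[of _ "c + c'"]) auto
qed

lemma exp_growth_mult:
  fixes f g :: "'a::real_normed_vector \<Rightarrow> real"
  assumes "exp_growth f" "exp_growth g" shows "exp_growth (\<lambda>x. f x * g x)"
proof -
  obtain K c K' c' where c: "0 \<le> c" "\<And>x. norm (f x) \<le> K * exp (c * norm x)"
      "0 \<le> c'" "\<And>x. norm (g x) \<le> K' * exp (c' * norm x)"
    using assms unfolding exp_growth_def by blast
  have K: "0 \<le> K"
    using order_trans[OF norm_ge_zero c(2)[of 0]] by simp
  have "norm (f x * g x) \<le> (K * K') * exp ((c + c') * norm x)" for x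
  proof -
    have "norm (f x * g x) \<le> (K * exp (c * norm x)) * (K' * exp (c' * norm x))"
      unfolding norm_mult using c K by (intro mult_mono) auto
    then show ?thesis unfolding distrib_right exp_add by (simp add: mult_ac)
  qed
  then show ?thesis unfolding exp_growth_def using c by (intro exI[of _ "K * K'"] exI[of _ "c + c'"]) auto
qed

lemma exp_growth_affine:
  assumes f: "exp_growth f" and l: "bounded_linear l" shows "exp_growth (\<lambda>x. f (m + l x))"
proof -
  obtain K c where c: "0 \<le> c" "\<And>x. norm (f x) \<le> K * exp (c * norm x)"
    using f by (auto simp: exp_growth_def)
  have K: "0 \<le> K"
    using order_trans[OF norm_ge_zero c(2)[of 0]] by simp
  obtain B where B: "0 \<le> B" "\<And>x. norm (l x) \<le> norm x * B"
    using bounded_linear.nonneg_bounded[OF l] by auto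
  have "norm (f (m + l x)) \<le> (K * exp (c * norm m)) * exp (c * B * norm x)" for x
  proof -
    have "norm (m + l x) \<le> norm m + B * norm x" using B(2)[of x] norm_triangle_ineq[of m "l x"] by (simp add: mult.commute)
    then have "c * norm (m + l x) \<le> c * (norm m + B * norm x)" using c(1) by (rule mult_left_mono)
    then have "exp (c * norm (m + l x)) \<le> exp (c * norm m) * exp (c * B * norm x)"
      by (simp add: exp_add[symmetric] algebra_simps)
    then have "K * exp (c * norm (m + l x)) \<le> K * (exp (c * norm m) * exp (c * B * norm x))"
      using K by (rule mult_left_mono)
    then show ?thesis using c(2)[of "m + l x"] by (simp add: mult_ac)
  qed
  then show ?thesis unfolding exp_growth_def using c(1) B(1)
    by (intro exI[of _ "K * exp (c * norm m)"] exI[of _ "c * B"]) auto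
qed

lemma exp_growth_linear_compose:
  assumes f: "exp_growth f" and l: "bounded_linear l" shows "exp_growth (\<lambda>x. l (f x))"
proof -
  obtain K c where c: "0 \<le> c" "\<And>x. norm (f x) \<le> K * exp (c * norm x)"
    using f by (auto simp: exp_growth_def)
  obtain B where B: "0 \<le> B" "\<And>x. norm (l x) \<le> norm x * B"
    using bounded_linear.nonneg_bounded[OF l] by auto
  have "norm (l (f x)) \<le> (K * B) * exp (c * norm x)" for x
    using B(2)[of "f x"] mult_right_mono[OF c(2)[of x] B(1)] by (simp add: mult_ac)
  then show ?thesis unfolding exp_growth_def using c(1) by blast
qed

section \<open>Gaussians as affine images of the standard one\<close>

lemma gauss_pdf_factor:
  fixes A :: "real^'n^'n"
  assumes A: "det A \<noteq> 0"
  shows "gauss_pdf m (A ** transpose A) (m + A *v x) * \<bar>det A\<bar> = gauss_pdf 0 (mat 1) x"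
    and "gauss_pdf m (A ** transpose A) (m + A *v x) =
      (2 * pi) powr (- real CARD('n) / 2) * \<bar>det A\<bar> powr (- 1) * exp (- (x \<bullet> x) / 2)"
proof -
  obtain N where N: "A ** N = mat 1" "N ** A = mat 1"
    using A by (auto simp: invertible_det_nz[symmetric] invertible_def)
  have tN: "transpose N ** transpose A = mat 1" "transpose A ** transpose N = mat 1"
    using N by (metis matrix_transpose_mul transpose_mat)+
  have inv: "matrix_inv (A ** transpose A) = transpose N ** N"
  proof (rule matrix_inv_unique)
    show "(A ** transpose A) ** (transpose N ** N) = mat 1"
      by (metis N(1) tN(2) matrix_mul_assoc matrix_mul_rid)
    show "(transpose N ** N) ** (A ** transpose A) = mat 1"
      by (metis N(2) tN(1) matrix_mul_assoc matrix_mul_rid)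
  qed
  have NA: "N *v (A *v x) = x" by (simp only: matrix_vector_mul_assoc N matrix_vector_mul_lid)
  have "(A *v x) \<bullet> ((transpose N ** N) *v (A *v x)) = (N *v (A *v x)) \<bullet> (N *v (A *v x))"
    by (simp only: matrix_vector_mul_assoc[symmetric] inner_matrix_vector_transpose[of _ "transpose N"] transpose_transpose)
  then have q: "(A *v x) \<bullet> ((transpose N ** N) *v (A *v x)) = x \<bullet> x" by (simp only: NA)
  \<comment> \<open>A power of |det A| covers factors with negative determinant: the exponent -1/2
    in the density turns it into 1 / |det A|.\<close>
  have d: "det (A ** transpose A) = \<bar>det A\<bar> powr 2"
    using A by (simp add: det_mul det_transpose powr_numeral power2_eq_square abs_mult_self_eq)
  show 2: "gauss_pdf m (A ** transpose A) (m + A *v x) =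
      (2 * pi) powr (- real CARD('n) / 2) * \<bar>det A\<bar> powr (- 1) * exp (- (x \<bullet> x) / 2)"
    unfolding gauss_pdf_def inv d powr_powr by (simp add: q)
  show "gauss_pdf m (A ** transpose A) (m + A *v x) * \<bar>det A\<bar> = gauss_pdf 0 (mat 1) x"
    unfolding 2 using A by (simp add: gauss_pdf_def powr_minus)
qed

text \<open>The Jacobian |det A| cancels the normalization of the density. The factor A is any
  invertible one, not just the principal square root, and this is what allows factors to be rotated
  later.\<close>

theorem gauss_eq_distr:
  fixes A :: "real^'n^'n"
  assumes A: "det A \<noteq> 0"
  shows "gauss m (A ** transpose A) = distr std_gauss borel (\<lambda>x. m + A *v x)"
proof (rule measure_eqI)
  fix X assume "X \<in> sets (gauss m (A ** transpose A))"
  then have X [measurable]: "X \<in> sets borel" by simp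
  let ?p = "gauss_pdf m (A ** transpose A)"
  have "emeasure (gauss m (A ** transpose A)) X = (\<integral>\<^sup>+x. ennreal (?p x) * indicator X x \<partial>lborel)"
    unfolding gauss_def by (subst emeasure_density) auto
  also have "\<dots> = (\<integral>\<^sup>+x. ennreal (?p (m + x)) * indicator X (m + x) \<partial>lborel)"
    by (rule lborel_nn_integral_translate[symmetric]) measurable
  also have "\<dots> = ennreal \<bar>det A\<bar> * (\<integral>\<^sup>+x. ennreal (?p (m + A *v x)) * indicator X (m + A *v x) \<partial>lborel)"
    by (rule lborel_nn_integral_linear[OF A]) measurable
  also have "\<dots> = (\<integral>\<^sup>+x. ennreal \<bar>det A\<bar> * (ennreal (?p (m + A *v x)) * indicator X (m + A *v x)) \<partial>lborel)"
    by (rule nn_integral_cmult[symmetric]) measurable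
  also have "\<dots> = (\<integral>\<^sup>+x. ennreal (gauss_pdf 0 (mat 1) x) * indicator X (m + A *v x) \<partial>lborel)"
    by (intro nn_integral_cong)
      (simp add: gauss_pdf_factor(1)[OF A, of m, symmetric] gauss_pdf_nonneg ennreal_mult'' ac_simps)
  also have "\<dots> = (\<integral>\<^sup>+x. indicator X (m + A *v x) \<partial>std_gauss)"
    unfolding gauss_def by (subst nn_integral_density) auto
  also have "\<dots> = (\<integral>\<^sup>+x. indicator X x \<partial>distr std_gauss borel (\<lambda>x. m + A *v x))"
    by (subst nn_integral_distr) auto
  also have "\<dots> = emeasure (distr std_gauss borel (\<lambda>x. m + A *v x)) X"
    by (rule nn_integral_indicator) simp
  finally show "emeasure (gauss m (A ** transpose A)) X = emeasure (distr std_gauss borel (\<lambda>x. m + A *v x)) X" .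
qed simp

lemma borel_measurable_gauss [simp]: "borel_measurable (gauss m S) = borel_measurable borel"
  by (rule measurable_cong_sets) simp_all

lemma measure_std_gauss_UNIV [simp]: "measure (std_gauss :: (real^'n) measure) UNIV = 1"
  using std_gauss.prob_space by simp

section \<open>Stein's identity\<close>

lemma abs_exp_minus_one_le: "\<bar>exp s - 1\<bar> \<le> \<bar>s\<bar> * exp \<bar>s\<bar>" for s :: real
proof (cases "0 \<le> s")
  case True
  have "1 - exp (- s) \<le> s" using exp_ge_add_one_self[of "-s"] by linarith
  then have "(1 - exp (- s)) * exp s \<le> s * exp s" by (rule mult_right_mono) simp
  then show ?thesis using True by (simp add: algebra_simps exp_add[symmetric])
next
  case False
  have "1 - exp s \<le> - s" using exp_ge_add_one_self[of s] by linarith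
  also have "\<dots> \<le> - s * exp (- s)" using False mult_left_mono[of 1 "exp (-s)" "-s"] by simp
  finally show ?thesis using False by (simp add: abs_if)
qed

text \<open>The Cameron-Martin formula: a translation moves the shift from g to the density, and
  expanding the square along the unit vector e leaves the exponential weight.\<close>

lemma std_gauss_integral_shift:
  fixes g :: "real^'n \<Rightarrow> real"
  assumes [measurable]: "g \<in> borel_measurable borel" and e: "norm e = 1"
  shows "(\<integral>x. g (x + t *\<^sub>R e) \<partial>std_gauss) = (\<integral>x. g x * exp (t * (x \<bullet> e) - t\<^sup>2 / 2) \<partial>std_gauss)"
proof -
  have ee: "e \<bullet> e = 1" using e by (simp add: norm_eq_1)
  let ?p = "gauss_pdf 0 (mat 1) :: real^'n \<Rightarrow> real"
  have p: "?p (x - t *\<^sub>R e) = ?p x * exp (t * (x \<bullet> e) - t\<^sup>2 / 2)" for x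
  proof -
    have "- ((x - t *\<^sub>R e) \<bullet> (x - t *\<^sub>R e)) / 2 = - (x \<bullet> x) / 2 + (t * (x \<bullet> e) - t\<^sup>2 / 2)"
      by (simp add: inner_diff_left inner_diff_right ee inner_commute[of e x] power2_eq_square right_diff_distrib)
    then show ?thesis
      by (simp only: gauss_pdf_def exp_add[symmetric] matrix_inv_mat_1 matrix_vector_mul_lid diff_zero mult.assoc)
  qed
  have "(\<integral>x. g (x + t *\<^sub>R e) \<partial>std_gauss) = (\<integral>x. ?p x * g (x + t *\<^sub>R e) \<partial>lborel)"
    unfolding gauss_def by (subst integral_density) (auto simp: gauss_pdf_nonneg)
  also have "\<dots> = (\<integral>x. ?p (x - t *\<^sub>R e) * g x \<partial>distr lborel borel ((+) (t *\<^sub>R e)))"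
    by (subst integral_distr) (auto simp: add.commute)
  also have "\<dots> = (\<integral>x. ?p x * (g x * exp (t * (x \<bullet> e) - t\<^sup>2 / 2)) \<partial>lborel)"
    unfolding lborel_distr_plus p by (simp add: mult_ac)
  also have "\<dots> = (\<integral>x. g x * exp (t * (x \<bullet> e) - t\<^sup>2 / 2) \<partial>std_gauss)"
    unfolding gauss_def by (subst integral_density) (auto simp: gauss_pdf_nonneg)
  finally show ?thesis .
qed

lemma exp_growth_inner: "exp_growth (\<lambda>x. x \<bullet> u)"
  by (rule exp_growth_linear_compose[OF exp_growth_ident bounded_linear_inner_left])

text \<open>The shift formula is differentiated at t = 0. Difference quotients of its left side
  converge to g', dominated by the Lipschitz constant; those of its right side converge to g x * (x
  . e), dominated by exponential growth.\<close>

theorem std_gauss_stein: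
  fixes g g' :: "real^'n \<Rightarrow> real"
  assumes e: "norm e = 1"
    and g [measurable]: "g \<in> borel_measurable borel" and g' [measurable]: "g' \<in> borel_measurable borel"
    and gr: "exp_growth g"
    and der: "\<And>x. ((\<lambda>t. g (x + t *\<^sub>R e)) has_real_derivative g' x) (at 0)"
    and lip: "\<And>x t. \<bar>g (x + t *\<^sub>R e) - g x\<bar> \<le> L * \<bar>t\<bar>"
  shows "(\<integral>x. g x * (x \<bullet> e) \<partial>std_gauss) = (\<integral>x. g' x \<partial>std_gauss)"
proof -
  \<comment> \<open>Steps in (0, 1] that tend to 0 without reaching it; the bound 1 gives a
    dominating function independent of k.\<close>
  define s where "s k = inverse (real (Suc k))" for k
  have s: "0 < s k" "s k \<le> 1" for k by (auto simp: s_def inverse_le_1_iff)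
  have s0: "s \<longlonglongrightarrow> 0" unfolding s_def by (rule LIMSEQ_inverse_real_of_nat)
  have s_at: "filterlim s (at 0) sequentially"
    using s0 s(1) by (auto simp: filterlim_at less_imp_neq[THEN not_sym])
  let ?L = "\<lambda>k x. (g (x + s k *\<^sub>R e) - g x) / s k"
  let ?R = "\<lambda>k x. g x * ((exp (s k * (x \<bullet> e) - (s k)\<^sup>2 / 2) - 1) / s k)"
  have xe: "\<bar>x \<bullet> e\<bar> \<le> norm x" for x using Cauchy_Schwarz_ineq2[of x e] e by simp
  have bnd: "\<bar>s k * (x \<bullet> e) - (s k)\<^sup>2 / 2\<bar> \<le> s k * (norm x + 1)" for k x
  proof -
    have "\<bar>s k * (x \<bullet> e) - (s k)\<^sup>2 / 2\<bar> \<le> s k * \<bar>x \<bullet> e\<bar> + s k * s k / 2"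
      using s[of k] abs_triangle_ineq4[of "s k * (x \<bullet> e)" "(s k)\<^sup>2 / 2"] by (simp add: abs_mult power2_eq_square)
    also have "\<dots> \<le> s k * norm x + s k * 1"
      using s[of k] xe[of x] by (intro add_mono mult_left_mono) (auto simp: mult_le_one order_trans[OF _ mult_left_mono[of "s k" 1 "s k"]])
    finally show ?thesis by (simp add: algebra_simps)
  qed
  \<comment> \<open>From |exp u - 1| <= |u| exp |u| with |u| <= s_k (|x| + 1): the factor s_k
    cancels against the quotient, and |x| + 1 <= exp |x|. The factors \<open>1 *\<close> fit the
    form of \<open>exp_growth_exp\<close>.\<close>
  let ?w = "\<lambda>x::real^'n. \<bar>g x\<bar> * (exp (1 * norm x) * (exp (1 * norm x) * exp 1))"
  have grw: "exp_growth ?w"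
    by (intro exp_growth_mult exp_growth_exp exp_growth_const exp_growth_mono[OF gr]) auto
  then have intw: "integrable std_gauss ?w" by (intro integrable_std_gauss) auto
  have Rw: "\<bar>?R k x\<bar> \<le> ?w x" for k x
  proof -
    let ?s = "s k * (x \<bullet> e) - (s k)\<^sup>2 / 2"
    have "\<bar>exp ?s - 1\<bar> \<le> \<bar>?s\<bar> * exp \<bar>?s\<bar>" by (rule abs_exp_minus_one_le)
    also have "\<dots> \<le> (s k * (norm x + 1)) * exp (norm x + 1)"
    proof (intro mult_mono)
      have "s k * (norm x + 1) \<le> norm x + 1" using s[of k] mult_right_mono[of "s k" 1 "norm x + 1"] by simp
      then show "exp \<bar>?s\<bar> \<le> exp (norm x + 1)" using bnd[of k x] by simp
    qed (use bnd[of k x] s[of k] in auto)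
    also have "\<dots> \<le> (s k * exp (norm x)) * exp (norm x + 1)"
      using s(1)[of k] exp_ge_add_one_self[of "norm x"] by (intro mult_right_mono mult_left_mono) (auto simp: add.commute)
    finally have "\<bar>exp ?s - 1\<bar> / s k \<le> exp (norm x) * (exp (norm x) * exp 1)"
      using s(1)[of k] by (simp add: field_simps exp_add)
    then have "\<bar>g x\<bar> * (\<bar>exp ?s - 1\<bar> / s k) \<le> \<bar>g x\<bar> * (exp (norm x) * (exp (norm x) * exp 1))"
      by (rule mult_left_mono) simp
    then show ?thesis using s(1)[of k] by (simp add: abs_mult abs_divide)
  qed
  have ig: "integrable std_gauss g" by (intro integrable_std_gauss gr) auto
  have igs: "integrable std_gauss (\<lambda>x. g (x + t *\<^sub>R e))" for t
    using exp_growth_affine[OF gr bounded_linear_ident, of "t *\<^sub>R e"]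
    by (intro integrable_std_gauss) (auto simp: add.commute)
  have iR: "integrable std_gauss (?R k)" for k
    by (rule Bochner_Integration.integrable_bound[OF intw]) (use Rw in auto)
  have ige: "integrable std_gauss (\<lambda>x. g x * exp (s k * (x \<bullet> e) - (s k)\<^sup>2 / 2))" for k
  proof -
    have "integrable std_gauss (\<lambda>x. s k * ?R k x + g x)"
      by (intro Bochner_Integration.integrable_add integrable_mult_right iR ig)
    moreover have "s k * ?R k x + g x = g x * exp (s k * (x \<bullet> e) - (s k)\<^sup>2 / 2)" for x
      using s(1)[of k] by (simp add: field_simps)
    ultimately show ?thesis by simp
  qed
  have eq: "(\<integral>x. ?L k x \<partial>std_gauss) = (\<integral>x. ?R k x \<partial>std_gauss)" for k
  proof -
    have "(\<integral>x. ?L k x \<partial>std_gauss) = ((\<integral>x. g (x + s k *\<^sub>R e) \<partial>std_gauss) - (\<integral>x. g x \<partial>std_gauss)) / s k"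
      by (simp add: ig igs)
    also have "\<dots> = ((\<integral>x. g x * exp (s k * (x \<bullet> e) - (s k)\<^sup>2 / 2) \<partial>std_gauss) - (\<integral>x. g x \<partial>std_gauss)) / s k"
      by (simp add: std_gauss_integral_shift[OF g e])
    also have "\<dots> = (\<integral>x. (g x * exp (s k * (x \<bullet> e) - (s k)\<^sup>2 / 2) - g x) / s k \<partial>std_gauss)"
      by (simp add: ig ige)
    also have "\<dots> = (\<integral>x. ?R k x \<partial>std_gauss)" by (simp add: algebra_simps diff_divide_distrib)
    finally show ?thesis .
  qed
  have L: "(\<lambda>k. \<integral>x. ?L k x \<partial>std_gauss) \<longlonglongrightarrow> (\<integral>x. g' x \<partial>std_gauss)"
  proof (rule integral_dominated_convergence[where w="\<lambda>_. L"])
    show "AE x in std_gauss. (\<lambda>k. ?L k x) \<longlonglongrightarrow> g' x"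
    proof (intro AE_I2)
      fix x
      have "((\<lambda>t. (g (x + t *\<^sub>R e) - g x) / t) \<longlongrightarrow> g' x) (at 0)"
        using der[of x] by (simp add: DERIV_def)
      from filterlim_compose[OF this s_at] show "(\<lambda>k. ?L k x) \<longlonglongrightarrow> g' x" .
    qed
    show "AE x in std_gauss. norm (?L k x) \<le> L" for k
      using lip[of _ "s k"] s(1)[of k] by (intro AE_I2) (simp add: abs_divide field_simps)
  qed auto
  have R: "(\<lambda>k. \<integral>x. ?R k x \<partial>std_gauss) \<longlonglongrightarrow> (\<integral>x. g x * (x \<bullet> e) \<partial>std_gauss)"
  proof (rule integral_dominated_convergence[where w="?w"])
    show "AE x in std_gauss. (\<lambda>k. ?R k x) \<longlonglongrightarrow> g x * (x \<bullet> e)"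
    proof (intro AE_I2)
      fix x
      have "((\<lambda>t. exp (t * (x \<bullet> e) - t\<^sup>2 / 2)) has_real_derivative (x \<bullet> e)) (at 0)"
        by (auto intro!: derivative_eq_intros)
      then have "((\<lambda>t. (exp (t * (x \<bullet> e) - t\<^sup>2 / 2) - 1) / t) \<longlongrightarrow> x \<bullet> e) (at 0)"
        by (simp add: DERIV_def)
      from filterlim_compose[OF this s_at]
      show "(\<lambda>k. ?R k x) \<longlonglongrightarrow> g x * (x \<bullet> e)" by (intro tendsto_mult_left)
    qed
    show "AE x in std_gauss. norm (?R k x) \<le> ?w x" for k using Rw by simp
  qed (use intw in auto)
  show ?thesis using L R unfolding eq by (rule LIMSEQ_unique[symmetric])
qed

section \<open>First and second moments\<close>

lemma exp_growth_nth: "exp_growth (\<lambda>x::real^'n. x $ i)"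
  by (rule exp_growth_linear_compose[OF exp_growth_ident bounded_linear_vec_nth])

text \<open>Stein's identity for a constant function; the second moments below come from a linear
  one.\<close>

lemma std_gauss_mean: "(\<integral>x. x $ j \<partial>(std_gauss :: (real^'n) measure)) = 0"
  using std_gauss_stein[of "axis j 1 :: real^'n" "\<lambda>_. 1" "\<lambda>_. 0" 0]
  by (simp add: inner_axis exp_growth_const)

lemma std_gauss_second_moment: "(\<integral>x. (x \<bullet> u) * x $ j \<partial>std_gauss) = u $ j" for u :: "real^'n"
proof -
  have "((\<lambda>t. (x + t *\<^sub>R axis j 1) \<bullet> u) has_real_derivative (u $ j)) (at 0)" for x
    by (auto simp: inner_add_left inner_axis' intro!: derivative_eq_intros)
  then have "(\<integral>x. (x \<bullet> u) * (x \<bullet> axis j 1) \<partial>std_gauss) = (\<integral>x. u $ j \<partial>(std_gauss :: (real^'n) measure))"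
    by (intro std_gauss_stein[where L="\<bar>u $ j\<bar>"])
      (auto simp: inner_add_left inner_axis' exp_growth_inner abs_mult)
  then show ?thesis by (simp add: inner_axis)
qed

lemma std_gauss_linear:
  "integrable std_gauss (\<lambda>x::real^'n. x \<bullet> u)" "(\<integral>x. x \<bullet> u \<partial>(std_gauss :: (real^'n) measure)) = 0"
proof -
  show "integrable std_gauss (\<lambda>x::real^'n. x \<bullet> u)"
    by (intro integrable_std_gauss exp_growth_inner) auto
  have i: "integrable std_gauss (\<lambda>x::real^'n. x $ i)" for i
    by (intro integrable_std_gauss exp_growth_nth) auto
  show "(\<integral>x. x \<bullet> u \<partial>(std_gauss :: (real^'n) measure)) = 0"
    by (simp add: inner_vec_def i std_gauss_mean)
qed

lemma std_gauss_quadratic: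
  "integrable std_gauss (\<lambda>x::real^'n. (x \<bullet> u)\<^sup>2)" "(\<integral>x. (x \<bullet> u)\<^sup>2 \<partial>(std_gauss :: (real^'n) measure)) = u \<bullet> u"
proof -
  show "integrable std_gauss (\<lambda>x::real^'n. (x \<bullet> u)\<^sup>2)"
    unfolding power2_eq_square by (intro integrable_std_gauss exp_growth_mult exp_growth_inner) auto
  have i: "integrable std_gauss (\<lambda>x::real^'n. (x \<bullet> u) * x $ i)" for i
    by (intro integrable_std_gauss exp_growth_mult exp_growth_inner exp_growth_nth) auto
  have "(\<integral>x. (x \<bullet> u)\<^sup>2 \<partial>(std_gauss :: (real^'n) measure)) = (\<integral>x. (\<Sum>j\<in>UNIV. u $ j * ((x \<bullet> u) * x $ j)) \<partial>(std_gauss :: (real^'n) measure))"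
    by (simp add: power2_eq_square inner_vec_def sum_distrib_left mult_ac)
  also have "\<dots> = (\<Sum>j\<in>UNIV. u $ j * u $ j)"
    by (simp add: i std_gauss_second_moment)
  finally show "(\<integral>x. (x \<bullet> u)\<^sup>2 \<partial>(std_gauss :: (real^'n) measure)) = u \<bullet> u" by (simp add: inner_vec_def)
qed

text \<open>The rows of M act as linear functionals, and their second moments add up to the squared
  Frobenius norm. Both the cost of a coupling with shared noise and the quadratic remainder of the
  lifted potential have this form, which is the origin of Euclidean geometry on pairs (m,
  A).\<close>

lemma std_gauss_affine_square:
  fixes M :: "real^'n^'n"
  shows "integrable std_gauss (\<lambda>x. (norm (a + M *v x))\<^sup>2)"
    and "(\<integral>x. (norm (a + M *v x))\<^sup>2 \<partial>std_gauss) = (norm a)\<^sup>2 + (norm M)\<^sup>2"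
proof -
  have c: "(norm (a + M *v x))\<^sup>2 = (\<Sum>i\<in>UNIV. (a $ i)\<^sup>2 + 2 * a $ i * (x \<bullet> (M $ i)) + (x \<bullet> (M $ i))\<^sup>2)" for x
    unfolding power2_norm_eq_inner inner_vec_def[of "a + M *v x"]
    by (intro sum.cong refl) (simp add: matrix_vector_mul_component
        inner_commute[of x] power2_eq_square algebra_simps)
  have i: "integrable std_gauss (\<lambda>x. (a $ i)\<^sup>2 + 2 * a $ i * (x \<bullet> (M $ i)) + (x \<bullet> (M $ i))\<^sup>2)" for i
    by (intro Bochner_Integration.integrable_add integrable_mult_right std_gauss_linear std_gauss_quadratic) simp
  show "integrable std_gauss (\<lambda>x. (norm (a + M *v x))\<^sup>2)"
    unfolding c by (intro Bochner_Integration.integrable_sum i)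
  have "(\<integral>x. (norm (a + M *v x))\<^sup>2 \<partial>std_gauss) = (\<Sum>i\<in>UNIV. (a $ i)\<^sup>2 + (M $ i) \<bullet> (M $ i))"
    unfolding c by (simp add: i std_gauss_linear std_gauss_quadratic)
  then show "(\<integral>x. (norm (a + M *v x))\<^sup>2 \<partial>std_gauss) = (norm a)\<^sup>2 + (norm M)\<^sup>2"
    unfolding power2_norm_eq_inner[of a] power2_norm_eq_inner[of M] inner_vec_def[of a] inner_vec_def[of M]
    by (simp add: sum.distrib power2_eq_square)
qed

section \<open>Entropy and transport cost in terms of factors\<close>

lemma integral_gauss:
  fixes A :: "real^'n^'n" and f :: "real^'n \<Rightarrow> 'b::{banach, second_countable_topology}"
  assumes "det A \<noteq> 0" and [measurable]: "f \<in> borel_measurable borel"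
  shows "(\<integral>x. f x \<partial>gauss m (A ** transpose A)) = (\<integral>x. f (m + A *v x) \<partial>std_gauss)"
  unfolding gauss_eq_distr[OF assms(1)] by (rule integral_distr) simp_all

text \<open>Here \<^term>\<open>det A\<close> may be negative: \<^term>\<open>ln (x::real)\<close> is the logarithm of the absolute value of \<open>x\<close>.\<close>
lemma entropy_factor:
  fixes A :: "real^'n^'n"
  assumes A: "det A \<noteq> 0"
  shows "entropy m (A ** transpose A) = entropy 0 (mat 1 :: real^'n^'n) - ln (det A)"
proof -
  define c where "c = - real CARD('n) / 2 * ln (2 * pi)"
  have i: "integrable std_gauss (\<lambda>x::real^'n. x \<bullet> x)"
    using std_gauss_affine_square(1)[of 0 "mat 1 :: real^'n^'n"] by (simp add: power2_norm_eq_inner)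
  \<comment> \<open>The second moment stays unevaluated: it is the same for every B and cancels
    against the case B = I.\<close>
  have E: "entropy m (B ** transpose B) = c - (\<integral>x. x \<bullet> x \<partial>(std_gauss :: (real^'n) measure)) / 2 - ln (det B)"
    if B: "det B \<noteq> 0" for B :: "real^'n^'n" and m
  proof -
    have "entropy m (B ** transpose B) = (\<integral>x. ln (gauss_pdf m (B ** transpose B) (m + B *v x)) \<partial>std_gauss)"
      unfolding entropy_def by (rule integral_gauss[OF B]) simp
    also have "(\<lambda>x. ln (gauss_pdf m (B ** transpose B) (m + B *v x))) = (\<lambda>x. c - ln (det B) - (x \<bullet> x) / 2)"
    proof
      have p: "ln \<bar>det B\<bar> = ln (det B)" by (cases "0 \<le> det B") (simp_all add: ln_minus)
      show "ln (gauss_pdf m (B ** transpose B) (m + B *v x)) = c - ln (det B) - (x \<bullet> x) / 2" for x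
        unfolding gauss_pdf_factor(2)[OF B] using B
        by (subst ln_mult_pos, simp, simp, subst ln_mult_pos, simp, simp)
          (simp only: ln_powr p ln_exp, simp add: c_def)
    qed
    finally show ?thesis by (simp add: i)
  qed
  show ?thesis using E[OF A] E[of "mat 1" 0] by simp
qed

text \<open>Both Gaussians are driven by the same standard normal variable. This coupling need not
  be optimal; its cost is the squared Euclidean distance of the pairs.\<close>

lemma W2_le:
  fixes A B :: "real^'n^'n"
  assumes A: "det A \<noteq> 0" and B: "det B \<noteq> 0"
  shows "W2 (gauss m (A ** transpose A)) (gauss n (B ** transpose B)) \<le> sqrt ((norm (m - n))\<^sup>2 + (norm (A - B))\<^sup>2)"
proof -
  let ?T = "\<lambda>x. (m + A *v x, n + B *v x)"
  let ?\<pi> = "distr std_gauss (borel \<Otimes>\<^sub>M borel) ?T"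
  let ?D = "(norm (m - n))\<^sup>2 + (norm (A - B))\<^sup>2"
  have T [measurable]: "?T \<in> measurable std_gauss (borel \<Otimes>\<^sub>M borel)"
    by (intro measurable_Pair) simp_all
  have "?\<pi> \<in> couplings (gauss m (A ** transpose A)) (gauss n (B ** transpose B))"
    unfolding couplings_def gauss_eq_distr[OF A] gauss_eq_distr[OF B]
    by (auto intro!: std_gauss.prob_space_distr simp: distr_distr comp_def)
  then have "(INF \<pi>\<in>couplings (gauss m (A ** transpose A)) (gauss n (B ** transpose B)).
      \<integral>\<^sup>+ z. ennreal ((norm (fst z - snd z))\<^sup>2) \<partial>\<pi>) \<le> (\<integral>\<^sup>+ z. ennreal ((norm (fst z - snd z))\<^sup>2) \<partial>?\<pi>)"
    by (rule INF_lower)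
  also have "\<dots> = (\<integral>\<^sup>+ x. ennreal ((norm ((m - n) + (A - B) *v x))\<^sup>2) \<partial>std_gauss)"
    by (subst nn_integral_distr) (auto simp: algebra_simps)
  also have "\<dots> = ennreal ?D"
    by (subst nn_integral_eq_integral) (auto simp: std_gauss_affine_square)
  finally show ?thesis unfolding W2_def
    by (intro real_sqrt_le_mono enn2real_leI) simp_all
qed

section \<open>The lifted potential\<close>

lemma vec_nth_measurable [measurable]:
  fixes f :: "'a \<Rightarrow> real^'n"
  assumes "f \<in> borel_measurable M" shows "(\<lambda>x. f x $ i) \<in> borel_measurable M"
  using assms by (rule measurable_compose) (intro borel_measurable_continuous_onI continuous_intros)

section \<open>Second differences and symmetry of the Hessian\<close>

lemma second_difference_mean_value:
  fixes V :: "'a::euclidean_space \<Rightarrow> real" and gradV :: "'a \<Rightarrow> 'a" and H :: "'a \<Rightarrow> 'a \<Rightarrow> 'a"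
  assumes grad: "\<And>x. (V has_derivative (\<lambda>h. gradV x \<bullet> h)) (at x)"
    and hess: "\<And>x. (gradV has_derivative H x) (at x)"
    and s: "0 < s"
  obtains z where "norm (z - x) \<le> s * (norm h + norm k)"
    "V (x + s *\<^sub>R h + s *\<^sub>R k) - V (x + s *\<^sub>R h) - V (x + s *\<^sub>R k) + V x = s\<^sup>2 * (h \<bullet> H z k)"
proof -
  \<comment> \<open>The second difference is the increment along h of an increment along k, so two
    applications of the mean value theorem produce one intermediate point.\<close>
  let ?\<phi> = "\<lambda>t. V (x + t *\<^sub>R h + s *\<^sub>R k) - V (x + t *\<^sub>R h)"
  have d1: "((\<lambda>t. V (y + t *\<^sub>R h)) has_real_derivative gradV (y + t *\<^sub>R h) \<bullet> h) (at t)" for y t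
    unfolding has_field_derivative_def
    by (rule has_derivative_eq_rhs[OF has_derivative_compose[where f="\<lambda>t. y + t *\<^sub>R h", OF _ grad]])
      (auto intro!: derivative_eq_intros simp: mult.commute)
  have "(?\<phi> has_real_derivative (gradV (x + t *\<^sub>R h + s *\<^sub>R k) \<bullet> h - gradV (x + t *\<^sub>R h) \<bullet> h)) (at t)" for t
    using DERIV_diff[OF d1[of "x + s *\<^sub>R k" t] d1[of x t]] by (simp add: algebra_simps)
  from MVT2[OF s, of ?\<phi>, OF this] obtain \<tau> where \<tau>: "0 < \<tau>" "\<tau> < s"
    "?\<phi> s - ?\<phi> 0 = s * (gradV (x + \<tau> *\<^sub>R h + s *\<^sub>R k) \<bullet> h - gradV (x + \<tau> *\<^sub>R h) \<bullet> h)" by auto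
  let ?\<psi> = "\<lambda>r. gradV (x + \<tau> *\<^sub>R h + r *\<^sub>R k) \<bullet> h"
  have lin: "linear (H y)" for y by (rule has_derivative_linear[OF hess])
  have "(?\<psi> has_real_derivative (H (x + \<tau> *\<^sub>R h + r *\<^sub>R k) k \<bullet> h)) (at r)" for r
  proof -
    have "((\<lambda>r. gradV (x + \<tau> *\<^sub>R h + r *\<^sub>R k)) has_derivative (\<lambda>u. H (x + \<tau> *\<^sub>R h + r *\<^sub>R k) (u *\<^sub>R k))) (at r)"
      by (rule has_derivative_compose[where f="\<lambda>r. x + \<tau> *\<^sub>R h + r *\<^sub>R k", OF _ hess])
        (auto intro!: derivative_eq_intros)
    from has_derivative_inner_left[OF this, of h] show ?thesis
      unfolding has_field_derivative_def
      by (rule has_derivative_eq_rhs) (auto simp: linear_scale[OF lin] mult.commute)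
  qed
  from MVT2[OF s, of ?\<psi>, OF this] obtain \<sigma> where \<sigma>: "0 < \<sigma>" "\<sigma> < s"
    "?\<psi> s - ?\<psi> 0 = s * (H (x + \<tau> *\<^sub>R h + \<sigma> *\<^sub>R k) k \<bullet> h)" by auto
  show thesis
  proof (rule that[of "x + \<tau> *\<^sub>R h + \<sigma> *\<^sub>R k"])
    have "norm (\<tau> *\<^sub>R h + \<sigma> *\<^sub>R k) \<le> \<tau> * norm h + \<sigma> * norm k"
      using norm_triangle_ineq[of "\<tau> *\<^sub>R h" "\<sigma> *\<^sub>R k"] \<tau> \<sigma> by simp
    also have "\<dots> \<le> s * norm h + s * norm k" using \<tau> \<sigma> by (intro add_mono mult_right_mono) auto
    finally show "norm (x + \<tau> *\<^sub>R h + \<sigma> *\<^sub>R k - x) \<le> s * (norm h + norm k)" by (simp add: algebra_simps)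
    have "V (x + s *\<^sub>R h + s *\<^sub>R k) - V (x + s *\<^sub>R h) - V (x + s *\<^sub>R k) + V x = ?\<phi> s - ?\<phi> 0" by simp
    also have "\<dots> = s * (?\<psi> s - ?\<psi> 0)" unfolding \<tau>(3) by simp
    also have "\<dots> = s\<^sup>2 * (h \<bullet> H (x + \<tau> *\<^sub>R h + \<sigma> *\<^sub>R k) k)"
      unfolding \<sigma>(3) by (simp add: power2_eq_square inner_commute)
    finally show "V (x + s *\<^sub>R h + s *\<^sub>R k) - V (x + s *\<^sub>R h) - V (x + s *\<^sub>R k) + V x
        = s\<^sup>2 * (h \<bullet> H (x + \<tau> *\<^sub>R h + \<sigma> *\<^sub>R k) k)" .
  qed
qed

text \<open>Schwarz's theorem: the second difference over a parallelogram is symmetric in h and k,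
  and as the parallelogram shrinks it approximates both mixed forms at x. Symmetry of the Hessian is
  thus derived from its continuity.\<close>

lemma second_derivative_symmetric:
  fixes V :: "'a::euclidean_space \<Rightarrow> real" and gradV :: "'a \<Rightarrow> 'a" and H :: "'a \<Rightarrow> 'a \<Rightarrow> 'a"
  assumes grad: "\<And>x. (V has_derivative (\<lambda>h. gradV x \<bullet> h)) (at x)"
    and hess: "\<And>x. (gradV has_derivative H x) (at x)"
    and cont: "\<And>k. continuous_on UNIV (\<lambda>x. H x k)"
  shows "h \<bullet> H x k = k \<bullet> H x h"
proof (rule ccontr)
  assume ne: "h \<bullet> H x k \<noteq> k \<bullet> H x h"
  define e where "e = \<bar>h \<bullet> H x k - k \<bullet> H x h\<bar> / 2"
  have e: "0 < e" using ne by (simp add: e_def)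
  have c: "isCont (\<lambda>z. h \<bullet> H z k) x" for h k
    using cont continuous_on_eq_continuous_at by (intro continuous_intros) blast
  obtain d1 where d1: "0 < d1" "\<And>z. dist z x < d1 \<Longrightarrow> \<bar>h \<bullet> H z k - h \<bullet> H x k\<bar> < e"
    using c[of h k, unfolded continuous_at_eps_delta] e by (metis dist_real_def)
  obtain d2 where d2: "0 < d2" "\<And>z. dist z x < d2 \<Longrightarrow> \<bar>k \<bullet> H z h - k \<bullet> H x h\<bar> < e"
    using c[of k h, unfolded continuous_at_eps_delta] e by (metis dist_real_def)
  \<comment> \<open>The scale keeps both intermediate points closer to x than min d1 d2; the summand
    1 excludes division by zero.\<close>
  define s where "s = min d1 d2 / (norm h + norm k + 1)"
  have pos: "0 < norm h + norm k + 1" by (simp add: add_nonneg_pos)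
  have s: "0 < s" unfolding s_def using d1 d2 pos by simp
  have "s * (norm h + norm k) < s * (norm h + norm k + 1)" using s by simp
  also have "\<dots> = min d1 d2" using pos by (simp add: s_def)
  finally have sm: "s * (norm h + norm k) < min d1 d2" .
  obtain z where z: "norm (z - x) \<le> s * (norm h + norm k)"
    "V (x + s *\<^sub>R h + s *\<^sub>R k) - V (x + s *\<^sub>R h) - V (x + s *\<^sub>R k) + V x = s\<^sup>2 * (h \<bullet> H z k)"
    by (rule second_difference_mean_value[OF grad hess s])
  obtain z' where z': "norm (z' - x) \<le> s * (norm k + norm h)"
    "V (x + s *\<^sub>R k + s *\<^sub>R h) - V (x + s *\<^sub>R k) - V (x + s *\<^sub>R h) + V x = s\<^sup>2 * (k \<bullet> H z' h)"
    by (rule second_difference_mean_value[OF grad hess s])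
  have "s\<^sup>2 * (h \<bullet> H z k) = s\<^sup>2 * (k \<bullet> H z' h)"
    using z(2) z'(2) by (simp add: algebra_simps)
  then have "h \<bullet> H z k = k \<bullet> H z' h" using s by simp
  moreover have "\<bar>h \<bullet> H z k - h \<bullet> H x k\<bar> < e"
    using z(1) sm by (intro d1(2)) (simp add: dist_norm)
  moreover have "\<bar>k \<bullet> H z' h - k \<bullet> H x h\<bar> < e"
    using z'(1) sm by (intro d2(2)) (simp add: dist_norm add.commute)
  ultimately show False unfolding e_def by (simp add: abs_if field_simps split: if_splits)
qed

section \<open>Pointwise bounds for the potential\<close>

locale smooth_convex_potential =
  fixes V :: "real^'n \<Rightarrow> real" and gradV :: "real^'n \<Rightarrow> real^'n" and hessV :: "real^'n \<Rightarrow> real^'n^'n"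
    and \<beta> :: real
  assumes grad: "\<And>x. (V has_derivative (\<lambda>h. gradV x \<bullet> h)) (at x)"
    and hess: "\<And>x. (gradV has_derivative (\<lambda>h. hessV x *v h)) (at x)"
    and hess_cont: "continuous_on UNIV hessV"
    and convex: "\<And>x h. 0 \<le> h \<bullet> (hessV x *v h)"
    and smooth: "\<And>x h. \<bar>h \<bullet> (hessV x *v h)\<bar> \<le> \<beta> * (h \<bullet> h)"
begin

lemma beta_nonneg: "0 \<le> \<beta>"
  using smooth[of "axis undefined 1" undefined] by (simp add: inner_axis_axis)

lemma V_measurable [measurable]: "V \<in> borel_measurable borel"
  using grad by (intro borel_measurable_continuous_onI)
    (metis continuous_on_eq_continuous_at has_derivative_continuous open_UNIV)

lemma gradV_measurable [measurable]: "gradV \<in> borel_measurable borel"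
  using hess by (intro borel_measurable_continuous_onI)
    (metis continuous_on_eq_continuous_at has_derivative_continuous open_UNIV)

lemma hessV_measurable [measurable]: "hessV \<in> borel_measurable borel"
  using hess_cont by (rule borel_measurable_continuous_onI)

lemma hess_mult_cont: "continuous_on UNIV (\<lambda>x. hessV x *v k)"
  unfolding matrix_vector_mult_def
  by (intro continuous_intros) (use hess_cont in \<open>auto intro!: continuous_intros\<close>)

lemma hess_commute: "h \<bullet> (hessV x *v k) = k \<bullet> (hessV x *v h)"
  by (rule second_derivative_symmetric[OF grad hess hess_mult_cont])

text \<open>Polarization of the quadratic bound.\<close>
lemma hess_bound: "norm (hessV x *v v) \<le> \<beta> * norm v"
proof (cases "hessV x *v v = 0")
  case False
  \<comment> \<open>H v rescaled to the length of v: polarization then gives the bound \<beta>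
    |v|^2, while u . H v = |v| |H v| exposes the norm to be estimated.\<close>
  define u where "u = (norm v / norm (hessV x *v v)) *\<^sub>R (hessV x *v v)"
  have nu: "norm u = norm v" using False by (simp add: u_def)
  have "4 * (u \<bullet> (hessV x *v v)) = (u + v) \<bullet> (hessV x *v (u + v)) - (u - v) \<bullet> (hessV x *v (u - v))"
    using hess_commute[of u x v] by (simp add: algebra_simps)
  also have "\<dots> \<le> \<beta> * ((u + v) \<bullet> (u + v)) + \<beta> * ((u - v) \<bullet> (u - v))"
    using smooth[of "u + v" x] smooth[of "u - v" x] by linarith
  also have "\<dots> = 2 * \<beta> * ((norm u)\<^sup>2 + (norm v)\<^sup>2)"
    by (simp add: power2_norm_eq_inner algebra_simps inner_commute)
  finally have "u \<bullet> (hessV x *v v) \<le> \<beta> * norm v * norm v" by (simp add: nu power2_eq_square)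
  moreover have "u \<bullet> (hessV x *v v) = norm v * norm (hessV x *v v)"
    using False by (simp add: u_def power2_norm_eq_inner[symmetric] power2_eq_square)
  moreover have "0 < norm v" using False by auto
  ultimately show ?thesis by (simp add: mult.commute)
qed (simp add: beta_nonneg)

lemma grad_lipschitz: "norm (gradV y - gradV x) \<le> \<beta> * norm (y - x)"
  using hess hess_bound
  by (intro differentiable_bound[of UNIV gradV "\<lambda>x h. hessV x *v h"])
    (auto intro: has_derivative_at_withinI onorm_le)

text \<open>Taylor expansion along the segment with Lagrange remainder: the Hessian form at one
  intermediate point is bounded below by convexity and above by smoothness.\<close>

lemma taylor_bounds:
  shows "0 \<le> V y - V x - gradV x \<bullet> (y - x)"
    and "V y - V x - gradV x \<bullet> (y - x) \<le> \<beta> / 2 * (norm (y - x))\<^sup>2"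
proof -
  let ?h = "y - x"
  \<comment> \<open>Derivatives along the segment in the sequence form that \<open>Maclaurin\<close>
    takes; with n = 2, orders above 2 are mere filler.\<close>
  define D where "D m t = (if m = 0 then V (x + t *\<^sub>R ?h) else if m = 1 then gradV (x + t *\<^sub>R ?h) \<bullet> ?h
      else ?h \<bullet> (hessV (x + t *\<^sub>R ?h) *v ?h))" for m :: nat and t
  have d1: "((\<lambda>t. V (x + t *\<^sub>R ?h)) has_real_derivative gradV (x + t *\<^sub>R ?h) \<bullet> ?h) (at t)" for t
    unfolding has_field_derivative_def
    by (rule has_derivative_eq_rhs[OF has_derivative_compose[where f="\<lambda>t. x + t *\<^sub>R ?h", OF _ grad]])
      (auto intro!: derivative_eq_intros simp: mult.commute)
  have d2: "((\<lambda>t. gradV (x + t *\<^sub>R ?h) \<bullet> ?h) has_real_derivative ?h \<bullet> (hessV (x + t *\<^sub>R ?h) *v ?h)) (at t)" for t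
  proof -
    have "((\<lambda>r. gradV (x + r *\<^sub>R ?h)) has_derivative (\<lambda>u. hessV (x + t *\<^sub>R ?h) *v (u *\<^sub>R ?h))) (at t)"
      by (rule has_derivative_compose[where f="\<lambda>r. x + r *\<^sub>R ?h", OF _ hess])
        (auto intro!: derivative_eq_intros)
    from has_derivative_inner_left[OF this, of ?h] show ?thesis
      unfolding has_field_derivative_def
      by (rule has_derivative_eq_rhs) (auto simp: matrix_vector_mult_scaleR inner_commute mult.commute)
  qed
  have "\<forall>m t. m < 2 \<and> 0 \<le> t \<and> t \<le> 1 \<longrightarrow> DERIV (D m) t :> D (Suc m) t"
    using d1 d2 by (auto simp: D_def[abs_def] less_2_cases_iff)
  from Maclaurin[of 1 2 D "D 0", OF _ _ refl this]
  obtain t where "D 0 1 = (\<Sum>m<2. D m 0 / fact m * 1 ^ m) + D 2 t / fact 2 * 1 ^ 2"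
    by auto
  then have "V y - V x - gradV x \<bullet> ?h = (?h \<bullet> (hessV (x + t *\<^sub>R ?h) *v ?h)) / 2"
    by (simp add: D_def numeral_2_eq_2)
  then show "0 \<le> V y - V x - gradV x \<bullet> (y - x)"
    "V y - V x - gradV x \<bullet> (y - x) \<le> \<beta> / 2 * (norm (y - x))\<^sup>2"
    using convex[of ?h "x + t *\<^sub>R ?h"] smooth[of ?h "x + t *\<^sub>R ?h"]
    by (simp_all add: power2_norm_eq_inner)
qed

lemma exp_growth_gradV: "exp_growth gradV"
proof (rule exp_growth_mono)
  show "exp_growth (\<lambda>x. norm (gradV 0) + \<beta> * norm x)"
    by (intro exp_growth_add exp_growth_mult exp_growth_const exp_growth_norm)
  show "norm (gradV x) \<le> norm (norm (gradV 0) + \<beta> * norm x)" for x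
    using grad_lipschitz[of x 0] norm_triangle_sub[of "gradV x" "gradV 0"] by simp
qed

lemma exp_growth_V: "exp_growth V"
proof (rule exp_growth_mono)
  show "exp_growth (\<lambda>x. \<bar>V 0\<bar> + norm (gradV 0) * norm x + \<beta> / 2 * (norm x * norm x))"
    by (intro exp_growth_add exp_growth_mult exp_growth_const exp_growth_norm)
  show "norm (V x) \<le> norm (\<bar>V 0\<bar> + norm (gradV 0) * norm x + \<beta> / 2 * (norm x * norm x))" for x
    using taylor_bounds[of x 0] Cauchy_Schwarz_ineq2[of "gradV 0" x] by (simp add: power2_eq_square)
qed

lemma exp_growth_hessV: "exp_growth hessV"
proof (rule exp_growth_mono)
  show "exp_growth (\<lambda>x::real^'n. real CARD('n) * (real CARD('n) * \<beta>))" by (rule exp_growth_const)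
  fix x
  have "norm (hessV x) \<le> (\<Sum>i\<in>UNIV. norm (hessV x $ i))"
    unfolding norm_vec_def[of "hessV x"] by (rule L2_set_le_sum) simp
  also have "\<dots> \<le> (\<Sum>i\<in>(UNIV::'n set). \<Sum>j\<in>(UNIV::'n set). \<beta>)"
  proof (intro sum_mono order_trans[OF norm_le_l1_cart])
    fix i j
    have "hessV x $ i $ j = (hessV x *v axis j 1) $ i" by (simp add: matrix_vector_mult_basis column_def)
    then show "\<bar>hessV x $ i $ j\<bar> \<le> \<beta>"
      using hess_bound[of x "axis j 1"] component_le_norm_cart[of "hessV x *v axis j 1" i] by simp
  qed
  finally show "norm (hessV x) \<le> norm (real CARD('n) * (real CARD('n) * \<beta>))" by simp
qed

text \<open>A may be singular, so the lift can be evaluated at a limit of factors before that limit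
  is known to be invertible.\<close>

definition lift :: "real^'n \<Rightarrow> real^'n^'n \<Rightarrow> real" where
  "lift m A = (\<integral>x. V (m + A *v x) \<partial>std_gauss)"

definition lift_grad :: "real^'n \<Rightarrow> real^'n^'n \<Rightarrow> real^'n" where
  "lift_grad m A = (\<integral>x. gradV (m + A *v x) \<partial>std_gauss)"

definition lift_hess :: "real^'n \<Rightarrow> real^'n^'n \<Rightarrow> real^'n^'n" where
  "lift_hess m A = (\<integral>x. hessV (m + A *v x) \<partial>std_gauss)"

lemma exp_growth_compose_affine:
  "exp_growth f \<Longrightarrow> exp_growth (\<lambda>x. f (m + (A::real^'n^'n) *v x))"
  by (rule exp_growth_affine) simp_all

lemma integrable_V: "integrable std_gauss (\<lambda>x. V (m + (A::real^'n^'n) *v x))"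
  by (rule integrable_std_gauss[OF _ exp_growth_compose_affine[OF exp_growth_V]]) measurable

lemma integrable_gradV: "integrable std_gauss (\<lambda>x. gradV (m + (A::real^'n^'n) *v x))"
  by (rule integrable_std_gauss[OF _ exp_growth_compose_affine[OF exp_growth_gradV]]) measurable

lemma integrable_hessV: "integrable std_gauss (\<lambda>x. hessV (m + (A::real^'n^'n) *v x))"
  by (rule integrable_std_gauss[OF _ exp_growth_compose_affine[OF exp_growth_hessV]]) measurable

lemma lift_hess_mult: "(lift_hess m A *v v) = (\<integral>x. hessV (m + A *v x) *v v \<partial>std_gauss)"
proof -
  have bl: "bounded_linear (\<lambda>M::real^'n^'n. M *v v)"
    by (intro linear_conv_bounded_linear[THEN iffD1] linearI)
      (simp_all add: matrix_vector_mult_add_rdistrib scaleR_matrix_vector_assoc)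
  show ?thesis unfolding lift_hess_def
    by (rule integral_bounded_linear[OF bl integrable_hessV, symmetric])
qed

lemma integrable_hessV_mult: "integrable std_gauss (\<lambda>x. hessV (m + (A::real^'n^'n) *v x) *v v)"
proof -
  have bl: "bounded_linear (\<lambda>M::real^'n^'n. M *v v)"
    by (intro linear_conv_bounded_linear[THEN iffD1] linearI)
      (simp_all add: matrix_vector_mult_add_rdistrib scaleR_matrix_vector_assoc)
  show ?thesis by (rule integrable_bounded_linear[OF bl integrable_hessV])
qed

lemma lift_hess_form: "u \<bullet> (lift_hess m A *v v) = (\<integral>x. u \<bullet> (hessV (m + A *v x) *v v) \<partial>std_gauss)"
  unfolding lift_hess_mult by (rule integral_inner_right[symmetric]) (rule integrable_hessV_mult)

lemma lift_hess_sym: "sym_mat (lift_hess m A)"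
proof -
  have "lift_hess m A $ i $ j = axis i 1 \<bullet> (lift_hess m A *v axis j 1)" for i j
    by (simp add: matrix_vector_mult_basis inner_axis' column_def)
  then show ?thesis
    by (simp add: sym_mat_def transpose_def vec_eq_iff lift_hess_form hess_commute[of "axis _ 1" _ "axis _ 1"])
qed

lemma lift_hess_le: "v \<bullet> (lift_hess m A *v v) \<le> \<beta> * (v \<bullet> v)"
proof -
  have "(\<integral>x. v \<bullet> (hessV (m + A *v x) *v v) \<partial>std_gauss) \<le> (\<integral>x. \<beta> * (v \<bullet> v) \<partial>(std_gauss :: (real^'n) measure))"
    by (intro integral_mono integrable_inner_right integrable_hessV_mult) (use smooth abs_le_D1 in auto)
  then show ?thesis by (simp add: lift_hess_form)
qed

text \<open>Stein's identity in coordinate j for the i-th component of the gradient; the chain rule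
  contributes the factor A. In this way the averaged Hessian used by the algorithm becomes the
  gradient of the lift in A.\<close>

lemma lift_stein:
  "(\<integral>x. gradV (m + A *v x) $ i * x $ j \<partial>std_gauss) = (lift_hess m A ** A) $ i $ j"
proof -
  let ?g = "\<lambda>x. gradV (m + A *v x) $ i" and ?e = "axis j 1 :: real^'n"
  let ?g' = "\<lambda>x. (hessV (m + A *v x) *v (A *v ?e)) $ i"
  have shift: "m + A *v (x + t *\<^sub>R ?e) = (m + A *v x) + t *\<^sub>R (A *v ?e)" for x t
    by (simp add: algebra_simps matrix_vector_mult_scaleR)
  have "(\<integral>x. ?g x * (x \<bullet> ?e) \<partial>std_gauss) = (\<integral>x. ?g' x \<partial>std_gauss)"
  proof (rule std_gauss_stein[where L="\<beta> * norm (A *v ?e)"])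
    show "norm ?e = 1" by simp
    show "?g \<in> borel_measurable borel" by measurable
    show "?g' \<in> borel_measurable borel"
    proof -
      have "(\<lambda>z. (hessV z *v (A *v ?e)) $ i) \<in> borel_measurable borel"
        by (intro borel_measurable_continuous_onI continuous_intros hess_mult_cont)
      then show ?thesis by measurable
    qed
    show "exp_growth ?g"
      using exp_growth_linear_compose[OF exp_growth_compose_affine[OF exp_growth_gradV] bounded_linear_vec_nth] .
    show "((\<lambda>t. ?g (x + t *\<^sub>R ?e)) has_real_derivative ?g' x) (at 0)" for x
    proof -
      have "((\<lambda>t. gradV (m + A *v (x + t *\<^sub>R ?e))) has_derivative
          (\<lambda>u. hessV (m + A *v (x + 0 *\<^sub>R ?e)) *v (u *\<^sub>R (A *v ?e)))) (at 0)"
        unfolding shift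
        by (rule has_derivative_compose[where f="\<lambda>t. m + A *v x + t *\<^sub>R (A *v ?e)", OF _ hess])
          (auto intro!: derivative_eq_intros)
      from bounded_linear.has_derivative[OF bounded_linear_vec_nth this, of i] show ?thesis
        unfolding has_field_derivative_def
        by (rule has_derivative_eq_rhs) (auto simp: matrix_vector_mult_scaleR mult.commute)
    qed
    show "\<bar>?g (x + t *\<^sub>R ?e) - ?g x\<bar> \<le> \<beta> * norm (A *v ?e) * \<bar>t\<bar>" for x t
    proof -
      have "\<bar>?g (x + t *\<^sub>R ?e) - ?g x\<bar> \<le> norm (gradV (m + A *v (x + t *\<^sub>R ?e)) - gradV (m + A *v x))"
        using component_le_norm_cart[of "gradV (m + A *v (x + t *\<^sub>R ?e)) - gradV (m + A *v x)" i] by simp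
      also have "\<dots> \<le> \<beta> * norm (t *\<^sub>R (A *v ?e))"
        using grad_lipschitz[of "m + A *v (x + t *\<^sub>R ?e)" "m + A *v x"] unfolding shift by simp
      finally show ?thesis by (simp add: mult_ac)
    qed
  qed
  also have "\<dots> = (lift_hess m A *v (A *v ?e)) $ i"
    unfolding lift_hess_mult by (rule integral_bounded_linear[OF bounded_linear_vec_nth integrable_hessV_mult])
  also have "\<dots> = (lift_hess m A ** A) $ i $ j"
    unfolding matrix_vector_mul_assoc matrix_vector_mult_basis[of "lift_hess m A ** A"] by (simp add: column_def)
  finally show ?thesis by (simp add: inner_axis)
qed

lemma lift_grad_inner:
  "integrable std_gauss (\<lambda>x. gradV (m + A *v x) \<bullet> (a + M *v x))"
  "(\<integral>x. gradV (m + A *v x) \<bullet> (a + M *v x) \<partial>std_gauss) = lift_grad m A \<bullet> a + (lift_hess m A ** A) \<bullet> M"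
proof -
  have i1: "integrable std_gauss (\<lambda>x. gradV (m + A *v x) \<bullet> a)"
    by (intro integrable_inner_left integrable_gradV)
  have i2: "integrable std_gauss (\<lambda>x. gradV (m + A *v x) $ i * x $ j)" for i j
    by (intro integrable_std_gauss exp_growth_mult exp_growth_nth
        exp_growth_linear_compose[OF exp_growth_compose_affine[OF exp_growth_gradV] bounded_linear_vec_nth]) measurable
  have eq: "gradV (m + A *v x) \<bullet> (a + M *v x)
     = gradV (m + A *v x) \<bullet> a + (\<Sum>i\<in>UNIV. \<Sum>j\<in>UNIV. M $ i $ j * (gradV (m + A *v x) $ i * x $ j))" for x
    unfolding inner_add_right inner_vec_def[of _ "M *v x"]
    by (simp add: matrix_vector_mult_def[of M] sum_distrib_left mult_ac)
  have i3: "integrable std_gauss (\<lambda>x. \<Sum>i\<in>UNIV. \<Sum>j\<in>UNIV. M $ i $ j * (gradV (m + A *v x) $ i * x $ j))"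
    by (intro Bochner_Integration.integrable_sum integrable_mult_right i2)
  show "integrable std_gauss (\<lambda>x. gradV (m + A *v x) \<bullet> (a + M *v x))"
    unfolding eq by (intro Bochner_Integration.integrable_add i1 i3)
  have "(\<integral>x. gradV (m + A *v x) \<bullet> (a + M *v x) \<partial>std_gauss) = (\<integral>x. gradV (m + A *v x) \<bullet> a \<partial>std_gauss)
     + (\<integral>x. (\<Sum>i\<in>UNIV. \<Sum>j\<in>UNIV. M $ i $ j * (gradV (m + A *v x) $ i * x $ j)) \<partial>std_gauss)"
    unfolding eq by (rule Bochner_Integration.integral_add[OF i1 i3])
  also have "(\<integral>x. gradV (m + A *v x) \<bullet> a \<partial>std_gauss) = lift_grad m A \<bullet> a"
    unfolding lift_grad_def using integrable_gradV by simp
  also have "(\<integral>x. (\<Sum>i\<in>UNIV. \<Sum>j\<in>UNIV. M $ i $ j * (gradV (m + A *v x) $ i * x $ j)) \<partial>std_gauss)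
     = (lift_hess m A ** A) \<bullet> M"
    by (simp add: i2 lift_stein inner_vec_def) (simp add: mult.commute)
  finally show "(\<integral>x. gradV (m + A *v x) \<bullet> (a + M *v x) \<partial>std_gauss) = lift_grad m A \<bullet> a + (lift_hess m A ** A) \<bullet> M" .
qed

text \<open>The pointwise Taylor bounds are averaged along the shared-noise coupling, where the
  difference of the two points is affine in the noise. This yields convexity and smoothness of the
  lift without differentiating under the integral.\<close>

lemma lift_bounds:
  fixes m n :: "real^'n" and A B :: "real^'n^'n"
  defines "r \<equiv> lift n B - lift m A - lift_grad m A \<bullet> (n - m) - (lift_hess m A ** A) \<bullet> (B - A)"
  shows "0 \<le> r" and "r \<le> \<beta> / 2 * ((norm (n - m))\<^sup>2 + (norm (B - A))\<^sup>2)"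
proof -
  let ?X = "\<lambda>x. m + A *v x" and ?Y = "\<lambda>x. n + B *v x"
  have d: "?Y x - ?X x = (n - m) + (B - A) *v x" for x by (simp add: algebra_simps)
  let ?r = "\<lambda>x. V (?Y x) - V (?X x) - gradV (?X x) \<bullet> (?Y x - ?X x)"
  have i: "integrable std_gauss ?r" unfolding d
    by (intro Bochner_Integration.integrable_diff integrable_V lift_grad_inner)
  have r: "r = (\<integral>x. ?r x \<partial>std_gauss)"
    unfolding d r_def by (simp add: integrable_V lift_grad_inner lift_def)
  show "0 \<le> r" unfolding r by (intro integral_nonneg_AE AE_I2 taylor_bounds)
  have "r \<le> (\<integral>x. \<beta> / 2 * (norm ((n - m) + (B - A) *v x))\<^sup>2 \<partial>std_gauss)"
    unfolding r
  proof (rule integral_mono[OF i])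
    show "integrable std_gauss (\<lambda>x. \<beta> / 2 * (norm ((n - m) + (B - A) *v x))\<^sup>2)"
      by (intro integrable_mult_right std_gauss_affine_square)
    show "?r x \<le> \<beta> / 2 * (norm ((n - m) + (B - A) *v x))\<^sup>2" for x
      using taylor_bounds(2)[of "?Y x" "?X x"] by (simp only: d)
  qed
  then show "r \<le> \<beta> / 2 * ((norm (n - m))\<^sup>2 + (norm (B - A))\<^sup>2)"
    by (simp add: std_gauss_affine_square)
qed

lemma free_energy_factor:
  assumes "det A \<noteq> 0"
  shows "free_energy V m (A ** transpose A) = lift m A + entropy 0 (mat 1 :: real^'n^'n) - ln (det A)"
  unfolding free_energy_def potential_def entropy_factor[OF assms] lift_def
  using integral_gauss[OF assms, of V m] by simp

text \<open>The lift is squeezed between its tangent at the limit and that tangent plus a quadratic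
  term.\<close>

lemma tendsto_lift:
  assumes m: "(m \<longlongrightarrow> m') F" and A: "(A \<longlongrightarrow> A') F"
  shows "((\<lambda>k. lift (m k) (A k)) \<longlongrightarrow> lift m' A') F"
proof (rule tendsto_sandwich)
  let ?l = "\<lambda>k. lift m' A' + lift_grad m' A' \<bullet> (m k - m') + (lift_hess m' A' ** A') \<bullet> (A k - A')"
  let ?u = "\<lambda>k. ?l k + \<beta> / 2 * ((norm (m k - m'))\<^sup>2 + (norm (A k - A'))\<^sup>2)"
  show "\<forall>\<^sub>F k in F. ?l k \<le> lift (m k) (A k)"
  proof (intro always_eventually allI)
    show "?l k \<le> lift (m k) (A k)" for k using lift_bounds(1)[of "m k" "A k" m' A'] by linarith
  qed
  show "\<forall>\<^sub>F k in F. lift (m k) (A k) \<le> ?u k"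
  proof (intro always_eventually allI)
    show "lift (m k) (A k) \<le> ?u k" for k using lift_bounds(2)[of "m k" "A k" m' A'] by linarith
  qed
  have "(?l \<longlongrightarrow> lift m' A' + lift_grad m' A' \<bullet> (m' - m') + (lift_hess m' A' ** A') \<bullet> (A' - A')) F"
    by (intro tendsto_intros m A)
  then show "(?l \<longlongrightarrow> lift m' A') F" by simp
  have "(?u \<longlongrightarrow> lift m' A' + lift_grad m' A' \<bullet> (m' - m') + (lift_hess m' A' ** A') \<bullet> (A' - A')
     + \<beta> / 2 * ((norm (m' - m'))\<^sup>2 + (norm (A' - A'))\<^sup>2)) F"
    by (intro tendsto_intros m A)
  then show "(?u \<longlongrightarrow> lift m' A') F" by simp
qed

end

section \<open>One step of the algorithm\<close>

lemma matrix_sub_rdistrib: "(A - B) ** C = A ** C - B ** C" for A B C :: "real^'n^'n"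
  by (simp add: matrix_matrix_mult_def vec_eq_iff left_diff_distrib sum_subtractf)

lemma matrix_sub_ldistrib: "A ** (B - C) = A ** B - A ** C" for A B C :: "real^'n^'n"
  by (simp add: matrix_matrix_mult_def vec_eq_iff right_diff_distrib sum_subtractf)

lemma scaleR_matrix_mult: "(c *\<^sub>R A) ** B = c *\<^sub>R (A ** B)" for A B :: "real^'n^'n"
  by (simp add: matrix_matrix_mult_def vec_eq_iff sum_distrib_left mult.assoc)

text \<open>The covariance update is the proximal step for \<open>- ln \<bar>det A\<bar>\<close> at the level of factors: the new factor
  solves \<open>A' - A = \<eta> (A'\<^sup>T)\<^sup>-\<^sup>1\<close>. This function is not convex on matrices, but the subgradient inequality
  holds against every \<open>B\<close> aligned with \<open>A\<close> in the sense that \<open>A\<^sup>T B\<close> is positive definite.\<close>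
lemma entropy_prox:
  fixes A :: "real^'n^'n"
  assumes A: "det A \<noteq> 0" and \<eta>: "0 < \<eta>"
  defines "S \<equiv> A ** transpose A"
  obtains A' where "det A' \<noteq> 0"
    "A' ** transpose A' = (1/2) *\<^sub>R (S + (2 * \<eta>) *\<^sub>R mat 1 + psd_sqrt (S ** (S + (4 * \<eta>) *\<^sub>R mat 1)))"
    "\<And>B. spd_mat (transpose A ** B) \<Longrightarrow> \<eta> * (ln (det B) - ln (det A')) \<le> (A' - A) \<bullet> (B - A')"
proof -
  have S: "spd_mat S" unfolding S_def by (rule spd_mat_mult_transpose[OF A])
  then obtain Q d where Q: "orthogonal_matrix Q" and Sd: "S = conj_diag Q d"
    using sym_mat_conj_diag by (metis spd_mat_def)
  have d: "0 < d i" for i using S Q Sd by (simp add: spd_conj_diag_iff)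
  \<comment> \<open>The positive root of c^2 = c + \<eta>/d. For A' = C A, with C in the eigenbasis
    of S, this is the scalar form of A' A'^T = A A'^T + \<eta> I, the stationarity condition of the
    proximal problem.\<close>
  define c where "c i = (1 + sqrt (1 + 4 * \<eta> / d i)) / 2" for i
  have c: "0 < c i" for i using d[of i] \<eta> by (simp add: c_def add_pos_nonneg)
  have c2: "c i * c i = c i + \<eta> / d i" for i
  proof -
    have "sqrt (1 + 4 * \<eta> / d i) * sqrt (1 + 4 * \<eta> / d i) = 1 + 4 * \<eta> / d i"
      using d[of i] \<eta> by simp
    then show ?thesis by (simp add: c_def algebra_simps add_divide_distrib)
  qed
  define C where "C = conj_diag Q c"
  define C' where "C' = conj_diag Q (\<lambda>i. 1 / c i)"
  have tC: "transpose C = C" using sym_mat_conj_diag_iff[of Q c] by (simp add: C_def sym_mat_def)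
  have C'C: "C' ** C = mat 1"
    using less_imp_neq[OF c] by (simp add: C_def C'_def conj_diag_mult[OF Q] conj_diag_one[OF Q])
  have spdC': "spd_mat C'" using c by (simp add: C'_def spd_conj_diag_iff[OF Q])
  have detC: "det C \<noteq> 0" using C'C by (metis det_I det_mul mult_zero_right zero_neq_one)
  define A' where "A' = C ** A"
  have dA': "det A' \<noteq> 0" using detC A by (simp add: A'_def det_mul)
  have CSC: "A' ** transpose A' = C ** S ** C"
    by (simp add: A'_def matrix_transpose_mul tC S_def matrix_mul_assoc)
  have sq: "psd_sqrt (S ** (S + (4 * \<eta>) *\<^sub>R mat 1)) = conj_diag Q (\<lambda>i. sqrt (d i * (d i + 4 * \<eta>)))"
  proof (rule psd_sqrt_eq)
    show "psd_mat (conj_diag Q (\<lambda>i. sqrt (d i * (d i + 4 * \<eta>))))"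
      using d \<eta> by (intro psd_conj_diag) (simp add: less_imp_le)
    have "0 \<le> d i * (d i + 4 * \<eta>)" for i using d[of i] \<eta> by simp
    then show "conj_diag Q (\<lambda>i. sqrt (d i * (d i + 4 * \<eta>))) ** conj_diag Q (\<lambda>i. sqrt (d i * (d i + 4 * \<eta>)))
       = S ** (S + (4 * \<eta>) *\<^sub>R mat 1)"
      by (simp add: Sd conj_diag_one[OF Q] conj_diag_mult[OF Q] conj_diag_add conj_diag_scaleR)
  qed
  \<comment> \<open>The eigenvalue c^2 d of the new covariance: the factor d moves under the square
    root in c and produces the update formula.\<close>
  have ds: "c i * d i * c i = (1/2) * (d i + (2 * \<eta>) + sqrt (d i * (d i + 4 * \<eta>)))" for i
  proof -
    have "d i * sqrt (1 + 4 * \<eta> / d i) = sqrt (d i * d i * (1 + 4 * \<eta> / d i))"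
      using d[of i] by (simp add: real_sqrt_mult)
    also have "d i * d i * (1 + 4 * \<eta> / d i) = d i * (d i + 4 * \<eta>)" using d[of i] by (simp add: field_simps)
    finally have s: "d i * sqrt (1 + 4 * \<eta> / d i) = sqrt (d i * (d i + 4 * \<eta>))" .
    have "c i * d i * c i = (c i * c i) * d i" by simp
    also have "\<dots> = d i * c i + \<eta>" unfolding c2 using d[of i] by (simp add: field_simps)
    also have "\<dots> = (d i + d i * sqrt (1 + 4 * \<eta> / d i)) / 2 + \<eta>" by (simp add: c_def algebra_simps)
    finally show ?thesis unfolding s by simp
  qed
  have 1: "A' ** transpose A' = (1/2) *\<^sub>R (S + (2 * \<eta>) *\<^sub>R mat 1 + psd_sqrt (S ** (S + (4 * \<eta>) *\<^sub>R mat 1)))"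
    unfolding CSC sq
    by (simp add: C_def Sd conj_diag_one[OF Q] conj_diag_mult[OF Q] conj_diag_add conj_diag_scaleR ds)
  have prox: "(A' - A) ** transpose A' = \<eta> *\<^sub>R mat 1"
  proof -
    have "C ** S ** C = S ** C + \<eta> *\<^sub>R mat 1"
    proof -
      have "c i * d i * c i = d i * c i + \<eta>" for i
        using c2[of i] d[of i] by (simp add: field_simps)
      then show ?thesis
        by (simp add: C_def Sd conj_diag_one[OF Q] conj_diag_mult[OF Q] conj_diag_add conj_diag_scaleR)
    qed
    moreover have "A' ** transpose A' = C ** S ** C" "A ** transpose A' = S ** C"
      by (simp_all add: A'_def matrix_transpose_mul tC S_def matrix_mul_assoc)
    ultimately show ?thesis by (simp add: matrix_sub_rdistrib)
  qed
  obtain N where N: "A' ** N = mat 1" "N ** A' = mat 1"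
    using dA' by (auto simp: invertible_det_nz[symmetric] invertible_def)
  obtain K where K: "A ** K = mat 1" "K ** A = mat 1"
    using A by (auto simp: invertible_det_nz[symmetric] invertible_def)
  have tK: "transpose K ** transpose A = mat 1" by (metis K(1) matrix_transpose_mul transpose_mat)
  have tN: "transpose A' ** transpose N = mat 1" by (metis N(2) matrix_transpose_mul transpose_mat)
  have dK: "det K \<noteq> 0" using K by (metis det_I det_mul mult_zero_right zero_neq_one)
  have NK: "N = K ** C'"
  proof -
    have "K ** C' ** A' = K ** (C' ** C) ** A" by (simp add: A'_def matrix_mul_assoc)
    then have "K ** C' ** A' = mat 1" by (simp add: C'C K)
    then show ?thesis by (metis N(1) matrix_mul_assoc matrix_mul_lid matrix_mul_rid)
  qed
  have diff: "A' - A = \<eta> *\<^sub>R transpose N"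
  proof -
    have "(A' - A) ** (transpose A' ** transpose N) = (\<eta> *\<^sub>R mat 1) ** transpose N"
      by (simp only: matrix_mul_assoc prox)
    then show ?thesis by (simp add: tN scaleR_matrix_mult)
  qed
  have 2: "\<eta> * (ln (det B) - ln (det A')) \<le> (A' - A) \<bullet> (B - A')" if B: "spd_mat (transpose A ** B)" for B
  proof -
    \<comment> \<open>A'^-1 B is not symmetric in general, but A'^-1 = K C' with K = A^-1, so it
      factors as (K C' K^T) (A^T B). The first factor is positive definite by congruence, the second
      by alignment.\<close>
    let ?P = "K ** C' ** transpose K"
    have P: "spd_mat ?P" by (rule spd_mat_congruence[OF spdC' dK])
    have NB: "?P ** (transpose A ** B) = N ** B"
    proof -
      have "?P ** (transpose A ** B) = K ** C' ** (transpose K ** transpose A) ** B"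
        by (simp add: matrix_mul_assoc)
      then show ?thesis by (simp add: tK NK)
    qed
    have dB: "det B \<noteq> 0" using spd_mat_det_pos[OF B] by (auto simp: det_mul)
    have dN: "det N * det A' = 1" using N by (metis det_I det_mul)
    then have "ln (det N) + ln (det A') = 0"
      using dA' by (metis ln_mult ln_one mult_zero_left zero_neq_one)
    moreover have "ln (det (N ** B)) = ln (det N) + ln (det B)"
      using dB dN by (auto simp: det_mul ln_mult)
    ultimately have "ln (det B) - ln (det A') = ln (det (N ** B))" by simp
    also have "\<dots> \<le> trace (N ** B) - real CARD('n)"
      using ln_det_mult_le_trace[OF P B] by (simp only: NB)
    \<comment> \<open>The dimension is the trace of \<open>N ** A'\<close>, so the constant is
      absorbed into the difference B - A'.\<close>
    also have "\<dots> = trace (N ** (B - A'))"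
      by (simp add: matrix_sub_ldistrib trace_sub N trace_I)
    also have "\<dots> = transpose N \<bullet> (B - A')" by (simp add: inner_matrix_trace)
    finally show ?thesis using \<eta> by (simp add: diff mult_left_mono)
  qed
  show thesis by (rule that[OF dA' 1 2])
qed

text \<open>The roles are: A the current factor, H the half step, P the new factor, B and B' the
  comparison factor before and after rotation. A rotation gives |B'| = |B|, and alignment with H
  then makes the right side nonnegative.\<close>

lemma prox_grad_identity:
  fixes A B H P B' :: "'a::real_inner"
  shows "(norm (A - B))\<^sup>2 - (norm (P - B'))\<^sup>2 - (2 * ((A - H) \<bullet> (P - B)) + (norm (P - A))\<^sup>2 + 2 * ((P - H) \<bullet> (B' - P)))
    = (norm B)\<^sup>2 - (norm B')\<^sup>2 + 2 * (H \<bullet> B' - H \<bullet> B)"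
  by (simp add: power2_norm_eq_inner algebra_simps inner_commute)

lemma ln_det_mult_orthogonal:
  fixes B U :: "real^'n^'n" assumes "orthogonal_matrix U" shows "ln (det (B ** U)) = ln (det B)"
  using det_orthogonal_matrix[OF assms] by (auto simp: det_mul ln_minus)

context smooth_convex_potential
begin

text \<open>The potential is compared with B and the entropy with the rotated B U, which represents
  the same Gaussian. The rotated factor is handed on as B', so it need not equal B.\<close>

theorem fb_step_descent:
  assumes \<eta>: "0 < \<eta>" "\<eta> * \<beta> < 1" and A: "det A \<noteq> 0" and B: "det B \<noteq> 0"
    and step: "fb_step \<eta> gradV hessV (m, A ** transpose A) = (m', S')"
  obtains A' B' where "det A' \<noteq> 0" "det B' \<noteq> 0" "A' ** transpose A' = S'"
    "B' ** transpose B' = B ** transpose B"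
    "(norm (m' - n))\<^sup>2 + (norm (A' - B'))\<^sup>2 \<le> (norm (m - n))\<^sup>2 + (norm (A - B))\<^sup>2
       - 2 * \<eta> * (free_energy V m' S' - free_energy V n (B ** transpose B))"
proof -
  let ?b = "lift_grad m A" and ?H = "lift_hess m A"
  let ?T = "mat 1 - \<eta> *\<^sub>R ?H"
  define G where "G = ?H ** A"
  define Ah where "Ah = ?T ** A"
  have Ah_eq: "A - Ah = \<eta> *\<^sub>R G"
    by (simp add: Ah_def G_def matrix_sub_rdistrib scaleR_matrix_mult)
  have tT: "transpose ?T = ?T"
    using lift_hess_sym[of m A] by (simp add: sym_mat_def transpose_def vec_eq_iff mat_def)
  have "det ?T \<noteq> 0"
  proof -
    \<comment> \<open>Here the strict bound \<eta> \<beta> < 1 enters: the averaged Hessian is at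
      most \<beta> I, so the forward map is positive definite and the half step stays
      nondegenerate.\<close>
    have "spd_mat ?T" unfolding spd_mat_def sym_mat_def
    proof (intro conjI allI impI tT)
      fix v :: "real^'n" assume v: "v \<noteq> 0"
      have "v \<bullet> (?T *v v) = v \<bullet> v - \<eta> * (v \<bullet> (?H *v v))"
        by (simp add: matrix_vector_mult_diff_rdistrib scaleR_matrix_vector_assoc[symmetric] inner_diff_right)
      moreover have "\<eta> * (v \<bullet> (?H *v v)) \<le> \<eta> * (\<beta> * (v \<bullet> v))"
        using \<eta>(1) lift_hess_le[of v m A] by (intro mult_left_mono) auto
      moreover have "(\<eta> * \<beta>) * (v \<bullet> v) < 1 * (v \<bullet> v)"
        using v \<eta>(2) by (intro mult_strict_right_mono) auto
      ultimately show "0 < v \<bullet> (?T *v v)" by (simp add: mult.assoc)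
    qed
    then show ?thesis using spd_mat_det_pos by force
  qed
  then have dAh: "det Ah \<noteq> 0" using A by (simp add: Ah_def det_mul)
  let ?S = "Ah ** transpose Ah"
  have S_eq: "?T ** (A ** transpose A) ** ?T = ?S"
    by (simp add: Ah_def matrix_transpose_mul tT matrix_mul_assoc)
  have b: "(\<integral>x. gradV x \<partial>gauss m (A ** transpose A)) = ?b"
    unfolding lift_grad_def by (rule integral_gauss[OF A]) simp
  have h: "(\<integral>x. hessV x \<partial>gauss m (A ** transpose A)) = ?H"
    unfolding lift_hess_def by (rule integral_gauss[OF A]) simp
  have m': "m' = m - \<eta> *\<^sub>R ?b"
    and S': "S' = (1/2) *\<^sub>R (?S + (2 * \<eta>) *\<^sub>R mat 1 + psd_sqrt (?S ** (?S + (4 * \<eta>) *\<^sub>R mat 1)))"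
    using step by (simp_all add: fb_step_def Let_def b h S_eq)
  obtain A' where A': "det A' \<noteq> 0" "A' ** transpose A' = S'"
    "\<And>B. spd_mat (transpose Ah ** B) \<Longrightarrow> \<eta> * (ln (det B) - ln (det A')) \<le> (A' - Ah) \<bullet> (B - A')"
    using entropy_prox[OF dAh \<eta>(1)] S' by metis
  obtain U where U: "orthogonal_matrix U" "spd_mat (transpose Ah ** (B ** U))" "Ah \<bullet> B \<le> Ah \<bullet> (B ** U)"
    using polar_alignment[OF dAh B] .
  let ?B' = "B ** U"
  have dB': "det ?B' \<noteq> 0" using B det_orthogonal_matrix[OF U(1)] by (auto simp: det_mul)
  have BB: "?B' ** transpose ?B' = B ** transpose B"
  proof -
    have "?B' ** transpose ?B' = B ** (U ** transpose U) ** transpose B"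
      by (simp add: matrix_transpose_mul matrix_mul_assoc)
    then show ?thesis using U(1) by (simp add: orthogonal_matrix_def)
  qed
  let ?D = "(norm (m' - m))\<^sup>2 + (norm (A' - A))\<^sup>2"
  have e1: "lift m' A' \<le> lift m A + ?b \<bullet> (m' - m) + G \<bullet> (A' - A) + \<beta> / 2 * ?D"
    using lift_bounds(2)[of m' A' m A] unfolding G_def by linarith
  have e2: "lift m A + ?b \<bullet> (n - m) + G \<bullet> (B - A) \<le> lift n B"
    using lift_bounds(1)[of n B m A] unfolding G_def by linarith
  have e3: "\<eta> * (ln (det B) - ln (det A')) \<le> (A' - Ah) \<bullet> (?B' - A')"
    using A'(3)[OF U(2)] by (simp add: ln_det_mult_orthogonal[OF U(1)])
  \<comment> \<open>The step size bound lets the squared displacement in the proximal gradient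
    identity pay for the smoothness remainder.\<close>
  have e4: "\<eta> * \<beta> * ?D \<le> ?D" using \<eta>(2) mult_right_mono[of "\<eta> * \<beta>" 1 ?D] by simp
  have F: "free_energy V m' S' - free_energy V n (B ** transpose B)
      = (lift m' A' - lift n B) + (ln (det B) - ln (det A'))"
    using free_energy_factor[OF A'(1), of m'] free_energy_factor[OF B, of n] by (simp add: A'(2))
  have "lift m' A' - lift n B \<le> ?b \<bullet> (m' - n) + G \<bullet> (A' - B) + \<beta> / 2 * ?D"
    using e1 e2 by (simp add: inner_diff_right)
  then have "2 * \<eta> * (lift m' A' - lift n B) \<le> 2 * \<eta> * (?b \<bullet> (m' - n) + G \<bullet> (A' - B) + \<beta> / 2 * ?D)"
    using \<eta>(1) by (intro mult_left_mono) auto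
  also have "\<dots> = 2 * \<eta> * (?b \<bullet> (m' - n)) + 2 * ((A - Ah) \<bullet> (A' - B)) + \<eta> * \<beta> * ?D"
    by (simp add: Ah_eq algebra_simps)
  also have "\<dots> \<le> 2 * \<eta> * (?b \<bullet> (m' - n)) + 2 * ((A - Ah) \<bullet> (A' - B)) + ?D" using e4 by simp
  finally have L: "2 * \<eta> * (lift m' A' - lift n B) \<le> 2 * \<eta> * (?b \<bullet> (m' - n)) + 2 * ((A - Ah) \<bullet> (A' - B)) + ?D" .
  \<comment> \<open>The mean has no proximal part, so its explicit gradient step contributes an
    exact identity.\<close>
  have M: "2 * \<eta> * (?b \<bullet> (m' - n)) + (norm (m' - m))\<^sup>2 = (norm (m - n))\<^sup>2 - (norm (m' - n))\<^sup>2"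
    unfolding m' power2_norm_eq_inner by (simp add: algebra_simps inner_commute power2_eq_square)
  \<comment> \<open>What remains by the identity is |B|^2 - |B U|^2 = 0 plus twice the gain in
    alignment.\<close>
  have "(norm (A - B))\<^sup>2 - (norm (A' - ?B'))\<^sup>2
      - (2 * ((A - Ah) \<bullet> (A' - B)) + (norm (A' - A))\<^sup>2 + 2 * ((A' - Ah) \<bullet> (?B' - A'))) \<ge> 0"
    unfolding prox_grad_identity using U(3) by (simp add: norm_mult_orthogonal[OF U(1)])
  with L M e3 have "(norm (m' - n))\<^sup>2 + (norm (A' - ?B'))\<^sup>2 \<le> (norm (m - n))\<^sup>2 + (norm (A - B))\<^sup>2
       - (2 * \<eta> * (lift m' A' - lift n B) + 2 * (\<eta> * (ln (det B) - ln (det A'))))" by linarith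
  also have "\<dots> = (norm (m - n))\<^sup>2 + (norm (A - B))\<^sup>2
       - 2 * \<eta> * (free_energy V m' S' - free_energy V n (B ** transpose B))"
    unfolding F by (simp add: algebra_simps)
  finally show thesis using that A' dB' BB by blast
qed

end

section \<open>Convergence\<close>

text \<open>The existential lets the factors change at every step, as the rotations demand; only the
  covariances are remembered. A bound r in place of the distance itself allows energy gaps to be
  subtracted from it.\<close>

definition coupled :: "real \<Rightarrow> (real^'n) \<times> (real^'n^'n) \<Rightarrow> (real^'n) \<times> (real^'n^'n) \<Rightarrow> bool" where
  "coupled r p q \<longleftrightarrow> (\<exists>A B. det A \<noteq> 0 \<and> det B \<noteq> 0 \<and> A ** transpose A = snd p \<and> B ** transpose B = snd q \<and>
     (norm (fst p - fst q))\<^sup>2 + (norm (A - B))\<^sup>2 \<le> r)"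

lemma coupled_nonneg: "coupled r p q \<Longrightarrow> 0 \<le> r"
  by (auto simp: coupled_def intro: order_trans[OF sum_power2_ge_zero])

lemma coupled_mono: "coupled r p q \<Longrightarrow> r \<le> s \<Longrightarrow> coupled s p q"
  unfolding coupled_def by (elim exE conjE, intro exI conjI) (assumption | erule order_trans)+

lemma coupled_spd: "coupled r p q \<Longrightarrow> spd_mat (snd p)"
  by (auto simp: coupled_def dest: spd_mat_mult_transpose)

lemma coupled_W2_le:
  assumes "coupled r p q"
  shows "W2 (gauss (fst p) (snd p)) (gauss (fst q) (snd q)) \<le> sqrt r"
proof -
  obtain A B where AB: "det A \<noteq> 0" "det B \<noteq> 0" "A ** transpose A = snd p" "B ** transpose B = snd q"
    "(norm (fst p - fst q))\<^sup>2 + (norm (A - B))\<^sup>2 \<le> r" using assms by (auto simp: coupled_def)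
  show ?thesis
    using W2_le[OF AB(1,2), of "fst p" "fst q"] real_sqrt_le_mono[OF AB(5)] unfolding AB(3,4) by linarith
qed

lemma coupled_exists:
  assumes "spd_mat (snd p)" "spd_mat (snd q)" obtains r where "coupled r p q"
proof -
  obtain A where A: "spd_mat A" "A ** A = snd p" using spd_mat_sqrt[OF assms(1)] .
  obtain B where B: "spd_mat B" "B ** B = snd q" using spd_mat_sqrt[OF assms(2)] .
  have "transpose A = A" "transpose B = B" using A B by (auto simp: spd_mat_def sym_mat_def)
  moreover have "det A \<noteq> 0" "det B \<noteq> 0"
    using spd_mat_det_pos[OF A(1)] spd_mat_det_pos[OF B(1)] by auto
  ultimately have "coupled ((norm (fst p - fst q))\<^sup>2 + (norm (A - B))\<^sup>2) p q"
    unfolding coupled_def using A B by (intro exI[of _ A] exI[of _ B]) simp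
  then show thesis by (rule that)
qed

lemma norm_factor: "(norm B)\<^sup>2 = trace (B ** transpose B)" for B :: "real^'n^'n"
  unfolding power2_norm_eq_inner inner_matrix_trace by (rule trace_mul_sym)

text \<open>The comparison factor B is unknown, but its Frobenius norm is the root of the trace of
  its covariance, so the bound depends on q and r alone.\<close>

lemma coupled_bounded:
  fixes p q :: "(real^'n) \<times> (real^'n^'n)"
  assumes "coupled r p q"
  obtains A where "det A \<noteq> 0" "A ** transpose A = snd p"
    "norm (fst p, A) \<le> 2 * sqrt r + norm (fst q) + sqrt (trace (snd q))"
proof -
  obtain A B where AB: "det A \<noteq> 0" "det B \<noteq> 0" "A ** transpose A = snd p" "B ** transpose B = snd q"
    "(norm (fst p - fst q))\<^sup>2 + (norm (A - B))\<^sup>2 \<le> r" using assms by (auto simp: coupled_def)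
  have "norm (fst p - fst q) \<le> sqrt r"
    using AB(5) by (intro real_le_rsqrt) (smt (verit) zero_le_power2)
  moreover have "norm (A - B) \<le> sqrt r"
    using AB(5) by (intro real_le_rsqrt) (smt (verit) zero_le_power2)
  moreover have "norm B = sqrt (trace (snd q))"
    using norm_factor[of B] AB(4) by (metis norm_ge_zero real_sqrt_unique)
  moreover have "norm (fst p) \<le> norm (fst p - fst q) + norm (fst q)" "norm A \<le> norm (A - B) + norm B"
    using norm_triangle_sub[of "fst p" "fst q"] norm_triangle_sub[of A B] by simp_all
  moreover have "norm (fst p, A) \<le> norm (fst p) + norm A" by (rule norm_Pair_le)
  ultimately have "norm (fst p, A) \<le> 2 * sqrt r + norm (fst q) + sqrt (trace (snd q))" by linarith
  with AB show thesis by (intro that)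
qed

lemma tendsto_det:
  fixes A :: "'a \<Rightarrow> real^'n^'n"
  assumes "(A \<longlongrightarrow> L) F" shows "((\<lambda>k. det (A k)) \<longlongrightarrow> det L) F"
  unfolding det_def by (intro tendsto_intros assms)

section \<open>Telescoping over the iterates and identification of the limit\<close>

context smooth_convex_potential
begin

context
  fixes \<eta> :: real
  assumes \<eta>: "0 < \<eta>" "\<eta> * \<beta> < 1"
begin

lemma coupled_fb_step:
  assumes "coupled r p q"
  shows "coupled (r - 2 * \<eta> * (free_energy V (fst (fb_step \<eta> gradV hessV p)) (snd (fb_step \<eta> gradV hessV p))
    - free_energy V (fst q) (snd q))) (fb_step \<eta> gradV hessV p) q"
proof -
  obtain A B where AB: "det A \<noteq> 0" "det B \<noteq> 0" "A ** transpose A = snd p" "B ** transpose B = snd q"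
    "(norm (fst p - fst q))\<^sup>2 + (norm (A - B))\<^sup>2 \<le> r" using assms by (auto simp: coupled_def)
  have step: "fb_step \<eta> gradV hessV (fst p, A ** transpose A)
      = (fst (fb_step \<eta> gradV hessV p), snd (fb_step \<eta> gradV hessV p))"
    by (simp add: AB(3))
  obtain A' B' where "det A' \<noteq> 0" "det B' \<noteq> 0" "A' ** transpose A' = snd (fb_step \<eta> gradV hessV p)"
    "B' ** transpose B' = B ** transpose B"
    "(norm (fst (fb_step \<eta> gradV hessV p) - fst q))\<^sup>2 + (norm (A' - B'))\<^sup>2
      \<le> (norm (fst p - fst q))\<^sup>2 + (norm (A - B))\<^sup>2
       - 2 * \<eta> * (free_energy V (fst (fb_step \<eta> gradV hessV p)) (snd (fb_step \<eta> gradV hessV p))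
       - free_energy V (fst q) (B ** transpose B))"
    using fb_step_descent[OF \<eta> AB(1,2) step] by metis
  then show ?thesis unfolding coupled_def using AB
    by (intro exI[of _ A'] exI[of _ B']) auto
qed

context
  fixes m0 :: "real^'n" and S0 :: "real^'n^'n"
  assumes init: "spd_mat S0"
begin

abbreviation iterate :: "nat \<Rightarrow> (real^'n) \<times> (real^'n^'n)" where
  "iterate k \<equiv> fb_gvi \<eta> gradV hessV m0 S0 k"

abbreviation energy :: "(real^'n) \<times> (real^'n^'n) \<Rightarrow> real" where
  "energy p \<equiv> free_energy V (fst p) (snd p)"

text \<open>The radius r is a budget from which each energy gap is paid, evaluated after the step,
  hence \<open>Suc\<close>. An arbitrary starting index k permits the later restart with another
  q.\<close>

lemma coupled_iterate:
  assumes "coupled r (iterate k) q"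
  shows "coupled (r - 2 * \<eta> * (\<Sum>i<j. energy (iterate (Suc (k + i))) - energy q)) (iterate (k + j)) q"
proof (induction j)
  case 0
  then show ?case using assms by simp
next
  case (Suc j)
  from coupled_fb_step[OF this] show ?case by (simp add: algebra_simps)
qed

lemma energy_minimizer_le:
  assumes "is_BW_minimizer V (fst q) (snd q)" "coupled r p q'" shows "energy q \<le> energy p"
  using assms coupled_spd[OF assms(2)] by (auto simp: is_BW_minimizer_def)

text \<open>Against a minimizer all gaps are nonnegative, so the budget never grows: a form of Fejer
  monotonicity.\<close>

lemma coupled_iterate_minimizer:
  assumes q: "is_BW_minimizer V (fst q) (snd q)" and c: "coupled r (iterate k) q"
  shows "energy q \<le> energy (iterate (k + j))" "coupled r (iterate (k + j)) q"
proof -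
  show e: "energy q \<le> energy (iterate (k + j))" for j
    by (rule energy_minimizer_le[OF q coupled_iterate[OF c]])
  have "0 \<le> (\<Sum>i<j. energy (iterate (Suc (k + i))) - energy q)"
    using e by (intro sum_nonneg) (metis add_Suc_right diff_ge_0_iff_ge)
  then show "coupled r (iterate (k + j)) q"
    using coupled_mono[OF coupled_iterate[OF c]] \<eta>(1) by simp
qed

text \<open>A coupling radius cannot become negative, which bounds the partial sums of the
  nonnegative gaps by r / (2 \<eta>); summable terms tend to zero.\<close>

lemma energy_tendsto:
  assumes q: "is_BW_minimizer V (fst q) (snd q)"
  shows "(\<lambda>k. energy (iterate k)) \<longlonglongrightarrow> energy q"
proof -
  obtain r where r: "coupled r (iterate 0) q"
    using coupled_exists[of "iterate 0" q] init q by (auto simp: is_BW_minimizer_def)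
  have "summable (\<lambda>i. energy (iterate (Suc i)) - energy q)"
  proof (rule bounded_imp_summable)
    show "0 \<le> energy (iterate (Suc i)) - energy q" for i
      using coupled_iterate_minimizer(1)[OF q r, of "Suc i"] by simp
    show "(\<Sum>i\<le>j. energy (iterate (Suc i)) - energy q) \<le> r / (2 * \<eta>)" for j
      using coupled_nonneg[OF coupled_iterate[OF r, of "Suc j"]] \<eta>(1)
      by (simp add: lessThan_Suc_atMost field_simps)
  qed
  then have "(\<lambda>i. energy (iterate (Suc i)) - energy q) \<longlonglongrightarrow> 0" by (rule summable_LIMSEQ_zero)
  then have "(\<lambda>i. energy (iterate (Suc i))) \<longlonglongrightarrow> energy q" by (simp add: LIM_zero_iff)
  then show ?thesis by (rule LIMSEQ_imp_Suc)
qed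

theorem fb_gvi_converges:
  assumes "\<exists>m S. is_BW_minimizer V m S"
  shows "\<exists>m S. is_BW_minimizer V m S \<and>
    (\<lambda>k. W2 (gauss (fst (iterate k)) (snd (iterate k))) (gauss m S)) \<longlonglongrightarrow> 0"
proof -
  \<comment> \<open>This minimizer supplies boundedness and the limiting energy; the limit of the
    iterates may be a different one.\<close>
  obtain q where q: "is_BW_minimizer V (fst q) (snd q)" using assms by auto
  obtain r where r: "coupled r (iterate 0) q"
    using coupled_exists[of "iterate 0" q] init q by (auto simp: is_BW_minimizer_def)
  define K where "K = 2 * sqrt r + norm (fst q) + sqrt (trace (snd q))"
  have "\<exists>A. det A \<noteq> 0 \<and> A ** transpose A = snd (iterate k) \<and> norm (fst (iterate k), A) \<le> K" for k
    using coupled_bounded[of r "iterate k" q] coupled_iterate_minimizer(2)[OF q r, of k]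
    unfolding K_def by auto
  then obtain A where A: "\<And>k. det (A k) \<noteq> 0" "\<And>k. A k ** transpose (A k) = snd (iterate k)"
    "\<And>k. norm (fst (iterate k), A k) \<le> K" by metis
  have "bounded (range (\<lambda>k. (fst (iterate k), A k)))"
    unfolding bounded_iff using A(3) by blast
  then obtain l s where s: "strict_mono (s :: nat \<Rightarrow> nat)"
    and l: "((\<lambda>k. (fst (iterate k), A k)) \<circ> s) \<longlonglongrightarrow> l"
    using bounded_imp_convergent_subsequence by blast
  define m' A' where "m' = fst l" and "A' = snd l"
  have lim_m: "(\<lambda>k. fst (iterate (s k))) \<longlonglongrightarrow> m'" and lim_A: "(\<lambda>k. A (s k)) \<longlonglongrightarrow> A'"
    using tendsto_fst[OF l] tendsto_snd[OF l] by (simp_all add: m'_def A'_def comp_def)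
  let ?c = "entropy 0 (mat 1 :: real^'n^'n)"
  \<comment> \<open>The value that ln |det| must approach, found by solving the energy formula for
    it.\<close>
  define L where "L = lift m' A' + ?c - energy q"
  have ln_eq: "ln (det (A (s k))) = lift (fst (iterate (s k))) (A (s k)) + ?c - energy (iterate (s k))" for k
    using free_energy_factor[OF A(1)[of "s k"], of "fst (iterate (s k))"] by (simp add: A(2))
  have "(\<lambda>k. energy (iterate (s k))) \<longlonglongrightarrow> energy q"
    using LIMSEQ_subseq_LIMSEQ[OF energy_tendsto[OF q] s] by (simp add: comp_def)
  then have "(\<lambda>k. ln (det (A (s k)))) \<longlonglongrightarrow> L"
    unfolding ln_eq L_def by (intro tendsto_intros tendsto_lift lim_m lim_A)
  \<comment> \<open>Exponentials avoid continuity of ln at det A', which might still vanish at this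
    point: |det| tends to exp L, which is positive.\<close>
  then have "(\<lambda>k. exp (ln (det (A (s k))))) \<longlonglongrightarrow> exp L" by (rule tendsto_exp)
  then have "(\<lambda>k. \<bar>det (A (s k))\<bar>) \<longlonglongrightarrow> exp L" using A(1) by (simp add: exp_ln_abs)
  moreover have "(\<lambda>k. \<bar>det (A (s k))\<bar>) \<longlonglongrightarrow> \<bar>det A'\<bar>"
    by (intro tendsto_rabs tendsto_det lim_A)
  ultimately have dA: "\<bar>det A'\<bar> = exp L" using LIMSEQ_unique by blast
  then have A'0: "det A' \<noteq> 0" by auto
  have "exp (ln (det A')) = exp L" using A'0 dA by (simp add: exp_ln_abs)
  then have "ln (det A') = L" by simp
  then have "free_energy V m' (A' ** transpose A') = energy q"
    using free_energy_factor[OF A'0, of m'] by (simp add: L_def)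
  then have min: "is_BW_minimizer V m' (A' ** transpose A')"
    using q spd_mat_mult_transpose[OF A'0] by (auto simp: is_BW_minimizer_def)
  \<comment> \<open>Measured with the very factors that converge along the subsequence, so it tends
    to zero; as a coupling radius at time s k it remains valid for all later iterates.\<close>
  define \<rho> where "\<rho> k = (norm (fst (iterate (s k)) - m'))\<^sup>2 + (norm (A (s k) - A'))\<^sup>2" for k
  have W: "W2 (gauss (fst (iterate (s k + j))) (snd (iterate (s k + j)))) (gauss m' (A' ** transpose A')) \<le> sqrt (\<rho> k)" for k j
  proof -
    have "coupled (\<rho> k) (iterate (s k)) (m', A' ** transpose A')"
      unfolding coupled_def using A A'0 by (intro exI[of _ "A (s k)"] exI[of _ A']) (auto simp: \<rho>_def)
    then have "coupled (\<rho> k) (iterate (s k + j)) (m', A' ** transpose A')"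
      using coupled_iterate_minimizer(2)[of "(m', A' ** transpose A')"] min by simp
    then show ?thesis using coupled_W2_le by fastforce
  qed
  have "(\<lambda>k. sqrt (\<rho> k)) \<longlonglongrightarrow> sqrt ((norm (m' - m'))\<^sup>2 + (norm (A' - A'))\<^sup>2)"
    unfolding \<rho>_def by (intro tendsto_intros lim_m lim_A)
  then have \<rho>0: "(\<lambda>k. sqrt (\<rho> k)) \<longlonglongrightarrow> 0" by simp
  have "(\<lambda>k. W2 (gauss (fst (iterate k)) (snd (iterate k))) (gauss m' (A' ** transpose A'))) \<longlonglongrightarrow> 0"
  proof (rule LIMSEQ_I)
    fix e :: real assume "0 < e"
    then have "\<forall>\<^sub>F k in sequentially. sqrt (\<rho> k) < e" using \<rho>0 by (rule order_tendstoD(2)[rotated])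
    \<comment> \<open>A single k is enough, because its bound covers every index from s k
      on.\<close>
    then obtain k where k: "sqrt (\<rho> k) < e" by (auto simp: eventually_sequentially)
    have "norm (W2 (gauss (fst (iterate i)) (snd (iterate i))) (gauss m' (A' ** transpose A')) - 0) < e"
      if i: "s k \<le> i" for i
    proof -
      have "0 \<le> W2 (gauss (fst (iterate i)) (snd (iterate i))) (gauss m' (A' ** transpose A'))"
        by (simp add: W2_def)
      moreover obtain j where "i = s k + j" using le_Suc_ex[OF i] by auto
      ultimately show ?thesis using W[of k j] k by simp
    qed
    then show "\<exists>N. \<forall>i\<ge>N. norm (W2 (gauss (fst (iterate i)) (snd (iterate i))) (gauss m' (A' ** transpose A')) - 0) < e"
      by blast
  qed
  with min show ?thesis by blast
qed

end

end

end

theorem mainTheorem2: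
  fixes V :: "real^'n \<Rightarrow> real"
    and gradV :: "real^'n \<Rightarrow> real^'n"
    and hessV :: "real^'n \<Rightarrow> real^'n^'n"
    and \<beta> \<eta> :: real and m0 :: "real^'n" and S0 :: "real^'n^'n"
  assumes grad: "\<And>x. (V has_derivative (\<lambda>h. gradV x \<bullet> h)) (at x)"
    and hess: "\<And>x. (gradV has_derivative (\<lambda>h. hessV x *v h)) (at x)"
    and hess_cont: "continuous_on UNIV hessV"
    and convex: "\<And>x h. 0 \<le> h \<bullet> (hessV x *v h)"
    and smooth: "\<And>x h. \<bar>h \<bullet> (hessV x *v h)\<bar> \<le> \<beta> * (h \<bullet> h)"
    and beta_pos: "\<beta> > 0"
    and has_min: "\<exists>m S. is_BW_minimizer V m S"
    and eta: "0 < \<eta>" "\<eta> < 1 / \<beta>"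
    and init: "spd_mat S0"
  shows "\<exists>mstar Sstar. is_BW_minimizer V mstar Sstar \<and>
    (\<lambda>k. W2 (gauss (fst (fb_gvi \<eta> gradV hessV m0 S0 k)) (snd (fb_gvi \<eta> gradV hessV m0 S0 k)))
              (gauss mstar Sstar)) \<longlonglongrightarrow> 0"
proof -
  interpret smooth_convex_potential V gradV hessV \<beta>
    by unfold_locales (fact grad hess hess_cont convex smooth)+
  have "\<eta> * \<beta> < 1" using eta(2) beta_pos by (simp add: field_simps)
  from fb_gvi_converges[OF eta(1) this init has_min] show ?thesis .
qed

end
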